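(* Let $G$ be a finite non-abelian group whose order is divisible by exactly three distinct primes. Then $G$ is exponent-critical if and only if $G$ is the direct product of a cyclic Sylow subgroup of $G$ and its complement, where this complement is a minimal non-abelian group (i.e. a non-abelian group all of whose proper subgroups are abelian).
   Context: A finite group $G$ is called exponent-critical if the exponent $\exp(G)$ of $G$ is not equal to the least common multiple of the exponents of the proper non-abelian subgroups of $G$. *)

theory Defs
  imports "HOL-Algebra.Algebra" "HOL-Computational_Algebra.Primes"
begin

text \<open>Exponent of a subgroup H of G: lcm of the orders of its elements
  (element orders in a subgroup coincide with those in G).\<close>
definition grp_exp :: "('a, 'b) monoid_scheme \<Rightarrow> 'a set \<Rightarrow> nat" where
  "grp_exp G H = Lcm (group.ord G ` H)"

definition commutative_set :: "('a, 'b) monoid_scheme \<Rightarrow> 'a set \<Rightarrow> bool" where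
  "commutative_set G H \<longleftrightarrow> (\<forall>x\<in>H. \<forall>y\<in>H. x \<otimes>\<^bsub>G\<^esub> y = y \<otimes>\<^bsub>G\<^esub> x)"

text \<open>G is exponent-critical: exp(G) differs from the lcm of the exponents of
  the proper non-abelian subgroups of G (the lcm over the empty family is 1).\<close>
definition exponent_critical :: "('a, 'b) monoid_scheme \<Rightarrow> bool" where
  "exponent_critical G \<longleftrightarrow>
     grp_exp G (carrier G) \<noteq>
     Lcm {grp_exp G H | H. subgroup H G \<and> H \<noteq> carrier G \<and> \<not> commutative_set G H}"

definition minimal_nonabelian_subgroup :: "('a, 'b) monoid_scheme \<Rightarrow> 'a set \<Rightarrow> bool" where
  "minimal_nonabelian_subgroup G K \<longleftrightarrow> subgroup K G \<and> \<not> commutative_set G K \<and>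
     (\<forall>L. subgroup L G \<and> L \<subseteq> K \<and> L \<noteq> K \<longrightarrow> commutative_set G L)"

definition sylow_subgroup :: "('a, 'b) monoid_scheme \<Rightarrow> nat \<Rightarrow> 'a set \<Rightarrow> bool" where
  "sylow_subgroup G p P \<longleftrightarrow> Factorial_Ring.prime p \<and> p dvd order G \<and> subgroup P G \<and>
     card P = p ^ multiplicity p (order G)"

definition cyclic_subgroup :: "('a, 'b) monoid_scheme \<Rightarrow> 'a set \<Rightarrow> bool" where
  "cyclic_subgroup G P \<longleftrightarrow> (\<exists>g\<in>carrier G. P = generate G {g})"

definition internal_direct_product :: "('a, 'b) monoid_scheme \<Rightarrow> 'a set \<Rightarrow> 'a set \<Rightarrow> bool" where
  "internal_direct_product G P K \<longleftrightarrow> subgroup P G \<and> subgroup K G \<and>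
     P \<inter> K = {\<one>\<^bsub>G\<^esub>} \<and> P <#>\<^bsub>G\<^esub> K = carrier G \<and>
     (\<forall>x\<in>P. \<forall>y\<in>K. x \<otimes>\<^bsub>G\<^esub> y = y \<otimes>\<^bsub>G\<^esub> x)"

end

theory Submission
  imports Defs
begin

text \<open>If \<open>G\<close> is exponent-critical, then some prime power \<open>p\<^sup>a > 1\<close> is the order of an element \<open>x\<close> of
  \<open>G\<close> but of no element of a proper non-abelian subgroup, so that every proper subgroup containing
  \<open>x\<close> is abelian. Let \<open>P\<close> be a Sylow \<open>p\<close>-subgroup containing \<open>x\<close>. As three primes divide the order
  of \<open>G\<close>, for \<open>q \<noteq> p\<close> a \<open>q\<close>-subgroup \<open>Q\<close> normalizing or normalized by \<open>P\<close> generates with \<open>P\<close> a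
  proper subgroup, whence \<open>Q\<close> centralizes \<open>P\<close>. In particular \<open>P\<close> is central if it is normal.

  In fact \<open>P\<close> is always central. Otherwise let \<open>M\<close> be the centralizer of a non-central \<open>y \<in> P\<close>. It is
  abelian and the unique maximal subgroup containing \<open>P\<close>, and \<open>P\<close> is not normal, so distinct
  conjugates of \<open>M\<close> intersect in the center. By transfer into \<open>M\<close> the derived subgroup \<open>G'\<close> has order
  prime to \<open>p\<close>, so it has \<open>P\<close>-invariant Sylow subgroups; these centralize \<open>P\<close> and lie in \<open>M\<close>. Hence
  \<open>G' \<subseteq> M\<close>, which makes \<open>P\<close> normal, a contradiction.

  Finally the kernel \<open>K\<close> of the transfer into the central subgroup \<open>P\<close> is a direct complement of
  \<open>P\<close>. Since \<open>\<langle>x\<rangle> K\<close> is not abelian it is all of \<open>G\<close>, so \<open>P = \<langle>x\<rangle>\<close>, and for \<open>L < K\<close> the proper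
  subgroup \<open>P L\<close> is abelian. Conversely, a subgroup of \<open>P \<times> K\<close> with an element of order divisible by
  \<open>|P|\<close> contains \<open>P\<close>, so if it is proper it meets \<open>K\<close> in an abelian group and is itself abelian.\<close>

subsection \<open>Sylow subgroups\<close>

text \<open>Elements of \<open>BijGroup E\<close> are extensional, so each map is cut down to
  \<open>E\<close> by \<open>restrict\<close>; bijectivity comes from the action of the
  inverse.\<close>

lemma (in group) group_action_restrictI:
  assumes closed: "\<And>g x. \<lbrakk>g \<in> carrier G; x \<in> E\<rbrakk> \<Longrightarrow> f g x \<in> E"
    and one: "\<And>x. x \<in> E \<Longrightarrow> f \<one> x = x"
    and mult: "\<And>g h x. \<lbrakk>g \<in> carrier G; h \<in> carrier G; x \<in> E\<rbrakk> \<Longrightarrow> f (g \<otimes> h) x = f g (f h x)"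
  shows "group_action G E (\<lambda>g. restrict (f g) E)"
proof -
  have inverse: "f (inv g) (f g x) = x" "f g (f (inv g) x) = x"
    if "g \<in> carrier G" "x \<in> E" for g x
    using that mult[of "inv g" g x] mult[of g "inv g" x] one by simp_all
  have bij: "restrict (f g) E \<in> Bij E" if g: "g \<in> carrier G" for g
    unfolding Bij_def
    by (auto intro!: bij_betw_byWitness[where f' = "f (inv g)"] simp: inverse closed g)
  have "restrict (f (g \<otimes> h)) E = compose E (restrict (f g) E) (restrict (f h) E)"
    if "g \<in> carrier G" "h \<in> carrier G" for g h
    using that by (auto simp: compose_def mult closed)
  then have "(\<lambda>g. restrict (f g) E) \<in> hom G (BijGroup E)"
    by (auto simp: hom_def BijGroup_def bij)
  then show ?thesis
    unfolding group_action_def group_hom_def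
    by (simp add: group_BijGroup group_hom_axioms.intro is_group)
qed

text \<open>Orbit sizes divide \<open>p ^ k\<close> and add up to \<open>card E\<close>. As
  \<open>p\<close> does not divide this sum, some orbit size is prime to \<open>p\<close> and hence
  equal to 1.\<close>

lemma (in group_action) prime_power_group_fixed_point:
  assumes "finite E" and p: "Factorial_Ring.prime p" and card: "order G = p ^ k"
    and ndvd: "\<not> p dvd card E"
  shows "\<exists>x\<in>E. \<forall>g\<in>carrier G. \<phi> g x = x"
proof -
  have "(\<Sum>orb\<in>orbits G E \<phi>. card orb) = card E"
    using disjoint_sum[OF \<open>finite E\<close>, where f = "\<lambda>_. 1::nat"] by simp
  with ndvd obtain orb where "orb \<in> orbits G E \<phi>" and orb: "\<not> p dvd card orb"
    by (metis dvd_sum)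
  then obtain x where x: "x \<in> E" and "orb = orbit G \<phi> x"
    by (auto simp: orbits_def)
  with orb have "\<not> p dvd card (orbit G \<phi> x)" by simp
  moreover have "card (orbit G \<phi> x) dvd p ^ k"
    using orbit_stabilizer_theorem[OF x] card by (metis dvd_triv_left)
  ultimately have "card (orbit G \<phi> x) = 1"
    using p by (metis divides_primepow_nat dvd_power gr0I power_0)
  moreover have "x \<in> orbit G \<phi> x"
    by (rule orbit_refl[OF x])
  ultimately have "orbit G \<phi> x = {x}"
    by (auto simp: card_1_singleton_iff)
  then show ?thesis
    using x by (auto simp: orbit_def)
qed

text \<open>Let \<open>H\<close> act on the right cosets of \<open>P\<close>, whose number is prime
  to \<open>p\<close>. A fixed coset \<open>P #> g\<close> means that conjugation by
  \<open>g\<close> carries \<open>H\<close> into \<open>P\<close>.\<close>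

lemma (in group) prime_power_subgroup_conjugate:
  assumes fin: "finite (carrier G)" and P: "subgroup P G" and H: "subgroup H G"
    and p: "Factorial_Ring.prime p" and card: "card H = p ^ k" and ndvd: "\<not> p dvd card (rcosets P)"
  shows "\<exists>g\<in>carrier G. \<forall>h\<in>H. g \<otimes> h \<otimes> inv g \<in> P"
proof -
  interpret P: subgroup P G by fact
  interpret H: subgroup H G by fact
  interpret H': group "G\<lparr>carrier := H\<rparr>" by (rule subgroup_imp_group[OF H])
  have sub: "C \<subseteq> carrier G" if "C \<in> rcosets P" for C
    using that rcosets_subset_PowG[OF P] by blast
  \<comment> \<open>Multiplying by \<open>inv h\<close> on the right makes this a left
    action.\<close>
  have "group_action (G\<lparr>carrier := H\<rparr>) (rcosets P) (\<lambda>h. \<lambda>C\<in>rcosets P. C #> inv h)"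
  proof (rule H'.group_action_restrictI)
    fix h C assume h: "h \<in> carrier (G\<lparr>carrier := H\<rparr>)" and C: "C \<in> rcosets P"
    then obtain g where "g \<in> carrier G" "C = P #> g" by (auto simp: RCOSETS_def)
    then show "C #> inv h \<in> rcosets P"
      using h by (simp add: coset_mult_assoc rcosetsI P.subset)
  next
    fix h k C assume "h \<in> carrier (G\<lparr>carrier := H\<rparr>)" "k \<in> carrier (G\<lparr>carrier := H\<rparr>)" "C \<in> rcosets P"
    then show "C #> inv (h \<otimes>\<^bsub>G\<lparr>carrier := H\<rparr>\<^esub> k) = C #> inv k #> inv h"
      by (simp add: inv_mult_group coset_mult_assoc sub)
  qed (simp add: sub)
  then have "\<exists>C\<in>rcosets P. \<forall>h\<in>carrier (G\<lparr>carrier := H\<rparr>). (\<lambda>C\<in>rcosets P. C #> inv h) C = C"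
  proof (rule group_action.prime_power_group_fixed_point[OF _ _ p _ ndvd])
    show "finite (rcosets P)"
      using fin rcosets_subset_PowG[OF P] by (meson finite_Pow_iff finite_subset)
    show "order (G\<lparr>carrier := H\<rparr>) = p ^ k"
      using card by (simp add: order_def)
  qed
  then obtain C where C: "C \<in> rcosets P" "\<And>h. h \<in> H \<Longrightarrow> C #> inv h = C"
    by auto
  from C(1) obtain g where g: "g \<in> carrier G" "C = P #> g" by (auto simp: RCOSETS_def)
  have "g \<otimes> h \<otimes> inv g \<in> P" if h: "h \<in> H" for h
  proof -
    have "P #> g = P #> (g \<otimes> h)"
      using C(2)[of "inv h"] h g by (simp add: coset_mult_assoc P.subset)
    then have "g \<otimes> h \<in> P #> g"
      using g h P rcos_self[of "g \<otimes> h" P] by simp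
    then show ?thesis
      using g h P.rcos_module_imp[OF is_group] by blast
  qed
  with g show ?thesis by blast
qed

section \<open>Conjugates, products and orders of subgroups\<close>

lemma (in group) conjugate_mult:
  assumes "a \<in> carrier G" "b \<in> carrier G" "x \<in> carrier G"
  shows "a \<otimes> b \<otimes> x \<otimes> inv (a \<otimes> b) = a \<otimes> (b \<otimes> x \<otimes> inv b) \<otimes> inv a"
  using assms by (simp add: inv_mult_group m_assoc)

lemma (in group) subgroup_conjugate_image:
  assumes Q: "subgroup Q G" and g: "g \<in> carrier G"
  shows "subgroup ((\<lambda>y. g \<otimes> y \<otimes> inv g) ` Q) G"
proof -
  interpret Q: subgroup Q G by fact
  interpret group_hom G G "\<lambda>y. g \<otimes> y \<otimes> inv g"
    by unfold_locales (use g in \<open>auto simp: hom_def m_assoc inv_solve_left\<close>)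
  show ?thesis by (rule subgroup_img_is_subgroup[OF Q])
qed

lemma (in group) card_conjugate_image:
  assumes "Q \<subseteq> carrier G" and "g \<in> carrier G"
  shows "card ((\<lambda>y. g \<otimes> y \<otimes> inv g) ` Q) = card Q"
proof (intro card_image inj_onI)
  fix x y
  assume "x \<in> Q" "y \<in> Q" "g \<otimes> x \<otimes> inv g = g \<otimes> y \<otimes> inv g"
  with assms show "x = y"
    by (metis inv_closed l_cancel m_closed right_cancel subsetD)
qed

text \<open>Finiteness makes every inverse a power, so closure under products is enough.\<close>

lemma (in group) finite_subgroupI:
  assumes fin: "finite (carrier G)" and sub: "H \<subseteq> carrier G" and one: "\<one> \<in> H"
    and mult: "\<And>x y. \<lbrakk>x \<in> H; y \<in> H\<rbrakk> \<Longrightarrow> x \<otimes> y \<in> H"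
  shows "subgroup H G"
proof (rule subgroupI)
  fix x assume x: "x \<in> H"
  then have xG: "x \<in> carrier G" using sub by blast
  have "x [^] (n::nat) \<in> H" for n
    by (induction n) (auto simp: one mult x)
  moreover have "inv x = x [^] (ord x - 1)"
  proof (rule inv_equality)
    have "x [^] (ord x - 1) \<otimes> x = x [^] Suc (ord x - 1)" by simp
    also have "Suc (ord x - 1) = ord x" using ord_ge_1[OF fin xG] by simp
    finally show "x [^] (ord x - 1) \<otimes> x = \<one>" using xG by simp
  qed (use xG in auto)
  ultimately show "inv x \<in> H" by simp
qed (use assms in auto)

lemma (in group) subgroup_set_mult_normalized:
  assumes A: "subgroup A G" and B: "subgroup B G"
    and normalizes: "\<And>a b. \<lbrakk>a \<in> A; b \<in> B\<rbrakk> \<Longrightarrow> b \<otimes> a \<otimes> inv b \<in> A"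
  shows "subgroup (A <#> B) G"
proof -
  interpret A: subgroup A G by fact
  interpret B: subgroup B G by fact
  show ?thesis
  proof (rule subgroupI)
    show "A <#> B \<subseteq> carrier G"
      by (rule set_mult_closed) auto
    show "A <#> B \<noteq> {}"
      using A.one_closed B.one_closed unfolding set_mult_def by blast
  next
    fix x assume "x \<in> A <#> B"
    then obtain a b where ab: "a \<in> A" "b \<in> B" "x = a \<otimes> b" by (auto simp: set_mult_def)
    then have "inv x = (inv b \<otimes> inv a \<otimes> inv (inv b)) \<otimes> inv b"
      by (simp add: inv_mult_group m_assoc)
    moreover have "inv b \<otimes> inv a \<otimes> inv (inv b) \<in> A"
      using ab by (intro normalizes) auto
    ultimately show "inv x \<in> A <#> B"
      using ab by (auto simp: set_mult_def)
  next
    fix x y assume "x \<in> A <#> B" "y \<in> A <#> B"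
    then obtain a b c d where ab: "a \<in> A" "b \<in> B" "c \<in> A" "d \<in> B" "x = a \<otimes> b" "y = c \<otimes> d"
      by (auto simp: set_mult_def)
    then have "x \<otimes> y = (a \<otimes> (b \<otimes> c \<otimes> inv b)) \<otimes> (b \<otimes> d)"
      by (simp add: m_assoc inv_solve_left)
    moreover have "a \<otimes> (b \<otimes> c \<otimes> inv b) \<in> A"
      using ab by (intro A.m_closed normalizes) auto
    ultimately show "x \<otimes> y \<in> A <#> B"
      using ab by (auto simp: set_mult_def)
  qed
qed

lemma (in group) set_mult_contains:
  assumes "subgroup A G" "subgroup B G"
  shows "A \<subseteq> A <#> B" and "B \<subseteq> A <#> B"
proof -
  interpret A: subgroup A G by fact
  interpret B: subgroup B G by fact
  have "a \<otimes> b \<in> A <#> B" if "a \<in> A" "b \<in> B" for a b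
    using that unfolding set_mult_def by blast
  from this[OF _ B.one_closed] this[OF A.one_closed]
  show "A \<subseteq> A <#> B" and "B \<subseteq> A <#> B"
    by (simp_all add: subset_iff)
qed

lemma card_set_mult_le:
  assumes "finite A" "finite B"
  shows "card (A <#>\<^bsub>G\<^esub> B) \<le> card A * card B"
proof -
  have "A <#>\<^bsub>G\<^esub> B = (\<lambda>(a, b). a \<otimes>\<^bsub>G\<^esub> b) ` (A \<times> B)"
    by (auto simp: set_mult_def)
  then show ?thesis
    using card_image_le[of "A \<times> B"] assms by (simp add: card_cartesian_product)
qed

lemma (in group) card_subgroup_dvd:
  assumes "subgroup H G" "subgroup K G" "H \<subseteq> K"
  shows "card H dvd card K"
proof -
  interpret K: group "G\<lparr>carrier := K\<rparr>" by (rule subgroup_imp_group) fact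
  show ?thesis
    using K.lagrange[OF subgroup_incl[OF assms]] dvd_triv_right
    by (auto simp: order_def dest: sym)
qed

section \<open>Sylow subgroups of a subgroup\<close>

lemma (in group) exists_sylow_subgroup:
  assumes fin: "finite (carrier G)" and K: "subgroup K G" and q: "Factorial_Ring.prime q"
    and dvd: "q ^ n dvd card K"
  shows "\<exists>Q. subgroup Q G \<and> Q \<subseteq> K \<and> card Q = q ^ n"
proof -
  interpret K: group "G\<lparr>carrier := K\<rparr>" by (rule subgroup_imp_group) fact
  obtain m where "card K = q ^ n * m" using dvd by blast
  then obtain Q where "subgroup Q (G\<lparr>carrier := K\<rparr>)" "card Q = q ^ n"
    using sylow_thm[OF q K.is_group, of n m] finite_subset[OF subgroup.subset[OF K] fin]
    by (auto simp: order_def)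
  then show ?thesis
    using incl_subgroup[OF K] subgroup.subset by fastforce
qed

text \<open>For every prime \<open>q\<close> the intersection of \<open>K\<close> and
  \<open>C\<close> contains a subgroup whose order is the full \<open>q\<close>-part of
  \<open>card K\<close>. So \<open>card K\<close> divides the order of the intersection, which is
  therefore all of \<open>K\<close>.\<close>

lemma (in group) subset_of_sylow_subsets:
  assumes fin: "finite (carrier G)" and K: "subgroup K G" and C: "subgroup C G"
    and sylow: "\<And>q. \<lbrakk>Factorial_Ring.prime q; q dvd card K\<rbrakk> \<Longrightarrow>
      \<exists>Q. subgroup Q G \<and> Q \<subseteq> K \<and> Q \<subseteq> C \<and> card Q = q ^ multiplicity q (card K)"
  shows "K \<subseteq> C"
proof -
  have finK: "finite K" using subgroup.subset[OF K] fin finite_subset by blast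
  have KC: "subgroup (K \<inter> C) G" by (rule subgroups_Inter_pair[OF K C])
  have pos: "card K \<noteq> 0" "card (K \<inter> C) \<noteq> 0"
    using subgroup.finite_imp_card_positive[OF K fin] subgroup.finite_imp_card_positive[OF KC fin]
    by auto
  have "card K dvd card (K \<inter> C)"
  proof (rule multiplicity_le_imp_dvd[OF pos(1)])
    fix q :: nat assume q: "Factorial_Ring.prime q"
    show "multiplicity q (card K) \<le> multiplicity q (card (K \<inter> C))"
    proof (cases "q dvd card K")
      case True
      then obtain Q where "subgroup Q G" "Q \<subseteq> K \<inter> C" "card Q = q ^ multiplicity q (card K)"
        using sylow[OF q] by blast
      then have "q ^ multiplicity q (card K) dvd card (K \<inter> C)"
        using card_subgroup_dvd[OF _ KC] by metis
      then show ?thesis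
        using pos(2) q by (intro multiplicity_geI) (auto dest: not_prime_unit)
    qed (simp add: not_dvd_imp_multiplicity_0)
  qed
  then have "card K \<le> card (K \<inter> C)"
    using pos by (auto intro: dvd_imp_le)
  then have "K \<inter> C = K"
    using finK by (intro card_seteq) auto
  then show ?thesis by blast
qed

text \<open>Otherwise Lagrange would give a power of \<open>p\<close> dividing
  \<open>order G\<close> beyond its multiplicity. Asking only for divisibility admits every subgroup
  that contains a Sylow subgroup.\<close>

lemma (in group) card_rcosets_not_dvd:
  assumes fin: "finite (carrier G)" and P: "subgroup P G" and p: "Factorial_Ring.prime p"
    and dvd: "p ^ multiplicity p (order G) dvd card P"
  shows "\<not> p dvd card (rcosets P)"
proof
  assume "p dvd card (rcosets P)"
  then have "p * p ^ multiplicity p (order G) dvd card (rcosets P) * card P"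
    using dvd by (intro mult_dvd_mono)
  then have "p ^ Suc (multiplicity p (order G)) dvd order G"
    by (simp add: lagrange[OF P])
  moreover have "order G \<noteq> 0" using fin order_gt_0_iff_finite by auto
  ultimately show False
    using p by (metis Suc_n_not_le_n multiplicity_geI not_prime_unit)
qed

text \<open>The Sylow $q$-subgroups of $K$ are permuted by $P$, and since $K$ permutes them transitively
  their number divides the order of $K$.\<close>
lemma (in group) exists_invariant_sylow_subgroup:
  assumes fin: "finite (carrier G)" and K: "K \<lhd> G" and P: "subgroup P G"
    and p: "Factorial_Ring.prime p" and cardP: "card P = p ^ k" and ndvd: "\<not> p dvd card K"
    and q: "Factorial_Ring.prime q"
  shows "\<exists>Q. subgroup Q G \<and> Q \<subseteq> K \<and> card Q = q ^ multiplicity q (card K) \<and>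
    (\<forall>y\<in>Q. \<forall>x\<in>P. x \<otimes> y \<otimes> inv x \<in> Q)"
proof -
  interpret K: normal K G by fact
  interpret P: subgroup P G by fact
  interpret K': group "G\<lparr>carrier := K\<rparr>" by (rule subgroup_imp_group) (rule K.subgroup_axioms)
  have finK: "finite K" using K.subset fin finite_subset by blast
  \<comment> \<open>\<open>E\<close> consists of the Sylow \<open>q\<close>-subgroups of
    \<open>K\<close>; normality of \<open>K\<close> lets \<open>G\<close> act on it by
    conjugation.\<close>
  define E where "E = {Q. subgroup Q G \<and> Q \<subseteq> K \<and> card Q = q ^ multiplicity q (card K)}"
  define f where "f = (\<lambda>g Q. (\<lambda>y. g \<otimes> y \<otimes> inv g) ` Q)"
  have "E \<subseteq> Pow K" by (auto simp: E_def)
  then have finE: "finite E" using finK by (meson finite_Pow_iff finite_subset)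
  have sub: "Q \<subseteq> carrier G" if "Q \<in> E" for Q
    using that subgroup.subset by (auto simp: E_def)
  have "group_action G E (\<lambda>g. restrict (f g) E)"
  proof (rule group_action_restrictI)
    fix g Q assume "g \<in> carrier G" "Q \<in> E"
    then show "f g Q \<in> E"
      by (auto simp: E_def f_def subgroup_conjugate_image card_conjugate_image subgroup.subset
          intro!: K.inv_op_closed2)
  next
    fix Q assume Q: "Q \<in> E"
    have "f \<one> Q = (\<lambda>y. y) ` Q"
      unfolding f_def using sub[OF Q] by (intro image_cong) auto
    then show "f \<one> Q = Q" by simp
  next
    fix g h Q assume "g \<in> carrier G" "h \<in> carrier G" "Q \<in> E"
    then show "f (g \<otimes> h) Q = f g (f h Q)"
      unfolding f_def image_image using sub[OF \<open>Q \<in> E\<close>]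
      by (intro image_cong) (simp_all add: conjugate_mult subset_iff)
  qed
  then interpret act: group_action G E "\<lambda>g. restrict (f g) E" .
  interpret actK: group_action "G\<lparr>carrier := K\<rparr>" E "\<lambda>g. restrict (f g) E"
    by (rule act.induced_action) (rule K.subgroup_axioms)
  interpret actP: group_action "G\<lparr>carrier := P\<rparr>" E "\<lambda>g. restrict (f g) E"
    by (rule act.induced_action[OF P])
  obtain Q0 where Q0: "Q0 \<in> E"
    using exists_sylow_subgroup[OF fin K.subgroup_axioms q multiplicity_dvd] by (auto simp: E_def)
  have "Q \<in> orbit (G\<lparr>carrier := K\<rparr>) (\<lambda>g. restrict (f g) E) Q0" if Q: "Q \<in> E" for Q
  proof -
    \<comment> \<open>Sylow conjugacy inside \<open>K\<close>: a conjugate of \<open>Q0\<close>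
      falls into \<open>Q\<close>, and equal cardinalities force equality.\<close>
    have "\<exists>g\<in>carrier (G\<lparr>carrier := K\<rparr>). \<forall>h\<in>Q0.
      g \<otimes>\<^bsub>G\<lparr>carrier := K\<rparr>\<^esub> h \<otimes>\<^bsub>G\<lparr>carrier := K\<rparr>\<^esub> inv\<^bsub>G\<lparr>carrier := K\<rparr>\<^esub> g \<in> Q"
    proof (rule K'.prime_power_subgroup_conjugate[OF _ _ _ q])
      show "subgroup Q (G\<lparr>carrier := K\<rparr>)" "subgroup Q0 (G\<lparr>carrier := K\<rparr>)"
        using Q Q0 subgroup_incl[OF _ K.subgroup_axioms] by (auto simp: E_def)
      then show "\<not> q dvd card (rcosets\<^bsub>G\<lparr>carrier := K\<rparr>\<^esub> Q)"
        using K'.card_rcosets_not_dvd[OF _ _ q] Q finK by (simp add: E_def order_def)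
      show "card Q0 = q ^ multiplicity q (card K)" using Q0 by (simp add: E_def)
    qed (simp add: finK)
    then obtain g where g: "g \<in> K" "f g Q0 \<subseteq> Q"
      by (auto simp: f_def m_inv_consistent[OF K.subgroup_axioms])
    have "f g Q0 = Q"
    proof (rule card_seteq)
      show "finite Q" using Q finK finite_subset by (auto simp: E_def)
      show "card Q \<le> card (f g Q0)"
        using Q Q0 g sub[OF Q0] by (simp add: E_def f_def card_conjugate_image)
    qed (rule g)
    then show ?thesis using g Q0 by (auto simp: orbit_def)
  qed
  then have "orbit (G\<lparr>carrier := K\<rparr>) (\<lambda>g. restrict (f g) E) Q0 = E"
    using Q0 actK.element_image by (fastforce simp: orbit_def)
  then have "card E dvd card K"
    using actK.orbit_stabilizer_theorem[OF Q0] by (auto simp: order_def dest: sym)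
  \<comment> \<open>The number of Sylow subgroups is thus prime to \<open>p\<close>, so the action
    of the \<open>p\<close>-group \<open>P\<close> has a fixed point.\<close>
  with ndvd have "\<not> p dvd card E" by (meson dvd_trans)
  then obtain Q where Q: "Q \<in> E" "\<And>x. x \<in> P \<Longrightarrow> f x Q = Q"
    using actP.prime_power_group_fixed_point[OF finE p, of k] cardP by (auto simp: order_def)
  have "x \<otimes> y \<otimes> inv x \<in> Q" if "x \<in> P" "y \<in> Q" for x y
    using imageI[OF that(2), of "\<lambda>y. x \<otimes> y \<otimes> inv x"] Q(2)[OF that(1)]
    by (simp add: f_def)
  with Q(1) show ?thesis
    unfolding E_def by blast
qed

subsection \<open>Transfer into an abelian subgroup\<close>

lemma (in group) inv_cancel_left:
  assumes "x \<in> carrier G" "y \<in> carrier G"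
  shows "inv x \<otimes> (x \<otimes> y) = y" "x \<otimes> (inv x \<otimes> y) = y"
  using assms by (simp_all add: m_assoc[symmetric])

text \<open>Outside \<open>M\<close> a representative of each double coset of \<open>M\<close> and
  \<open>Y\<close> is fixed, and \<open>f g\<close> is the factor \<open>h\<close> from
  \<open>M\<close> in \<open>g = h r u\<close>. The hypothesis \<open>free\<close> makes
  \<open>h\<close> unique, so it is not affected by right multiplication with \<open>Y\<close>. For
  trivial \<open>Y\<close> the hypothesis is automatic, and what remains is a map equivariant under
  \<open>M\<close>.\<close>

lemma (in group) exists_coset_equivariant_map:
  assumes M: "subgroup M G" and Y: "subgroup Y G" "Y \<subseteq> M"
    and free: "\<And>r u. \<lbrakk>r \<in> carrier G - M; u \<in> Y; r \<otimes> u \<otimes> inv r \<in> M\<rbrakk> \<Longrightarrow> u = \<one>"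
  shows "\<exists>f \<in> carrier G \<rightarrow> M. (\<forall>h\<in>M. \<forall>g\<in>carrier G. f (h \<otimes> g) = h \<otimes> f g) \<and> (\<forall>h\<in>M. f h = h) \<and>
    (\<forall>g\<in>carrier G - M. \<forall>u\<in>Y. f (g \<otimes> u) = f g)"
proof -
  interpret M: subgroup M G by fact
  interpret Y: subgroup Y G by fact
  \<comment> \<open>\<open>D g\<close> is the double coset of \<open>g\<close>. Because
    \<open>r\<close> chooses from the set \<open>D g\<close>, it takes the same value at all
    elements of a double coset.\<close>
  define D where "D g = {h \<otimes> g \<otimes> u | h u. h \<in> M \<and> u \<in> Y}" for g
  define r where "r g = (SOME t. t \<in> D g)" for g
  define f where "f g = (if g \<in> M then g else THE h. h \<in> M \<and> (\<exists>u\<in>Y. g = h \<otimes> r g \<otimes> u))" for g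
  have YG: "u \<in> carrier G" if "u \<in> Y" for u using that by simp
  have self: "g \<in> D g" if "g \<in> carrier G" for g
    using that by (auto simp: D_def intro!: exI[of _ \<one>])
  have D_sub: "D (h \<otimes> g \<otimes> u) \<subseteq> D g" if "g \<in> carrier G" "h \<in> M" "u \<in> Y" for g h u
  proof
    fix t assume "t \<in> D (h \<otimes> g \<otimes> u)"
    then obtain h' u' where t: "h' \<in> M" "u' \<in> Y" "t = h' \<otimes> (h \<otimes> g \<otimes> u) \<otimes> u'"
      by (auto simp: D_def)
    then have "t = (h' \<otimes> h) \<otimes> g \<otimes> (u \<otimes> u')"
      using that by (simp add: m_assoc)
    moreover have "h' \<otimes> h \<in> M" "u \<otimes> u' \<in> Y" using t that by auto
    ultimately show "t \<in> D g" unfolding D_def by blast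
  qed
  have D_eq: "D (h \<otimes> g \<otimes> u) = D g" if "g \<in> carrier G" "h \<in> M" "u \<in> Y" for g h u
  proof
    have "D (inv h \<otimes> (h \<otimes> g \<otimes> u) \<otimes> inv u) \<subseteq> D (h \<otimes> g \<otimes> u)"
      by (rule D_sub) (use that in auto)
    also have "inv h \<otimes> (h \<otimes> g \<otimes> u) \<otimes> inv u = g"
      using that by (simp add: m_assoc inv_cancel_left)
    finally show "D g \<subseteq> D (h \<otimes> g \<otimes> u)" .
  qed (rule D_sub[OF that])
  have f_eqI: "f g = h" if g: "g \<in> carrier G - M" and h: "h \<in> M" and u: "u \<in> Y" and eq: "g = h \<otimes> r g \<otimes> u"
    and rG: "r g \<in> carrier G" for g h u
  proof -
    have rM: "r g \<notin> M"
    proof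
      assume "r g \<in> M"
      then have "h \<otimes> r g \<otimes> u \<in> M" using h u Y(2) by auto
      with eq g show False by auto
    qed
    have "h' = h" if h': "h' \<in> M" and u': "u' \<in> Y" and eq': "g = h' \<otimes> r g \<otimes> u'" for h' u'
    proof -
      have G: "h \<in> carrier G" "h' \<in> carrier G" "u \<in> carrier G" "u' \<in> carrier G"
        using h h' u u' by auto
      have "h \<otimes> r g \<otimes> u = h' \<otimes> r g \<otimes> u'" using eq eq' by metis
      then have "inv h \<otimes> (h \<otimes> r g \<otimes> u) \<otimes> (inv u' \<otimes> inv (r g)) =
          inv h \<otimes> (h' \<otimes> r g \<otimes> u') \<otimes> (inv u' \<otimes> inv (r g))"
        by simp
      \<comment> \<open>Two decompositions differ by an element of \<open>Y\<close> that
        \<open>r g\<close> conjugates into \<open>M\<close>; by \<open>free\<close> it is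
        trivial.\<close>
      then have key: "r g \<otimes> (u \<otimes> inv u') \<otimes> inv (r g) = inv h \<otimes> h'"
        using G rG by (simp add: m_assoc inv_cancel_left)
      have "u \<otimes> inv u' = \<one>"
        using free[of "r g" "u \<otimes> inv u'"] rG rM key h h' u u' by auto
      with key have "inv h \<otimes> h' = \<one>" using rG by simp
      then show "h' = h" using G by (metis inv_closed inv_equality inv_inv)
    qed
    then have "(THE h. h \<in> M \<and> (\<exists>u\<in>Y. g = h \<otimes> r g \<otimes> u)) = h"
      using h u eq by (intro the_equality) blast+
    then show ?thesis using g by (simp add: f_def)
  qed
  have rD: "r g \<in> D g" if "g \<in> carrier G" for g
    unfolding r_def using self[OF that] by (rule someI)
  have rG: "r g \<in> carrier G" if "g \<in> carrier G" for g
    using rD[OF that] that by (auto simp: D_def)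
  have decomp: "\<exists>h\<in>M. \<exists>u\<in>Y. g = h \<otimes> r g \<otimes> u" if g: "g \<in> carrier G" for g
  proof -
    obtain h u where hu: "h \<in> M" "u \<in> Y" "r g = h \<otimes> g \<otimes> u"
      using rD[OF g] by (auto simp: D_def)
    then have "g = inv h \<otimes> r g \<otimes> inv u"
      using g by (simp add: m_assoc inv_cancel_left)
    with hu show ?thesis by (meson M.m_inv_closed Y.m_inv_closed)
  qed
  have shift: "f (h \<otimes> g \<otimes> u) = h \<otimes> f g" if g: "g \<in> carrier G - M" and h: "h \<in> M" and u: "u \<in> Y" for g h u
  proof -
    have G: "g \<in> carrier G" "h \<in> carrier G" "u \<in> carrier G" using g h u by auto
    have r_eq: "r (h \<otimes> g \<otimes> u) = r g" unfolding r_def using D_eq[OF G(1) h u] by simp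
    obtain h' u' where hu': "h' \<in> M" "u' \<in> Y" "g = h' \<otimes> r g \<otimes> u'"
      using decomp[OF G(1)] by blast
    then have fg: "f g = h'" using f_eqI[OF g] rG[OF G(1)] by blast
    have notin: "h \<otimes> g \<otimes> u \<notin> M"
    proof
      assume "h \<otimes> g \<otimes> u \<in> M"
      then have "inv h \<otimes> (h \<otimes> g \<otimes> u) \<otimes> inv u \<in> M"
        using h u Y(2) by auto
      also have "inv h \<otimes> (h \<otimes> g \<otimes> u) \<otimes> inv u = g"
        using G by (simp add: m_assoc inv_cancel_left)
      finally show False using g by simp
    qed
    have "h \<otimes> g \<otimes> u = h \<otimes> (h' \<otimes> r g \<otimes> u') \<otimes> u" using hu'(3) by simp
    also have "\<dots> = h \<otimes> h' \<otimes> r g \<otimes> (u' \<otimes> u)"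
      using hu'(1,2) G rG[OF G(1)] by (simp add: m_assoc)
    finally have eq: "h \<otimes> g \<otimes> u = h \<otimes> h' \<otimes> r (h \<otimes> g \<otimes> u) \<otimes> (u' \<otimes> u)"
      unfolding r_eq .
    have "f (h \<otimes> g \<otimes> u) = h \<otimes> h'"
    proof (rule f_eqI[OF _ _ _ eq])
      show "r (h \<otimes> g \<otimes> u) \<in> carrier G" unfolding r_eq by (rule rG[OF G(1)])
      show "h \<otimes> g \<otimes> u \<in> carrier G - M" using notin G by simp
    qed (use h u hu'(1,2) in auto)
    then show ?thesis by (simp add: fg)
  qed
  show ?thesis
  proof (intro bexI[of _ f] conjI ballI)
    fix h g assume h: "h \<in> M" and g: "g \<in> carrier G"
    show "f (h \<otimes> g) = h \<otimes> f g"
    proof (cases "g \<in> M")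
      case True
      then show ?thesis using h by (simp add: f_def)
    next
      case False
      then show ?thesis using shift[of g h \<one>] g h by simp
    qed
  next
    fix g u assume "g \<in> carrier G - M" "u \<in> Y"
    moreover from this have "f g \<in> carrier G"
      using decomp[of g] f_eqI[of g] rG by (metis DiffD1 M.mem_carrier)
    ultimately show "f (g \<otimes> u) = f g" using shift[of g \<one> u] by simp
  next
    show "f \<in> carrier G \<rightarrow> M"
    proof
      fix g assume g: "g \<in> carrier G"
      show "f g \<in> M"
        using decomp[OF g] f_eqI[of g] rG[OF g] g by (cases "g \<in> M") (auto simp: f_def)
    qed
  qed (simp add: f_def)
qed

text \<open>The transfer homomorphism into an abelian subgroup \<open>M\<close>. Instead of a transversal, it is
  given by a map \<open>f\<close> that commutes with left multiplication by \<open>M\<close>: the factor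
  \<open>f (t g) f(t)\<^sup>-\<^sup>1\<close> depends only on the coset of \<open>t\<close>.\<close>
locale abelian_transfer = group G + subgroup M G for G (structure) and M +
  fixes f :: "'a \<Rightarrow> 'a"
  assumes finite_carrier: "finite (carrier G)"
    and commutes: "\<And>x y. \<lbrakk>x \<in> M; y \<in> M\<rbrakk> \<Longrightarrow> x \<otimes> y = y \<otimes> x"
    and f_closed: "\<And>g. g \<in> carrier G \<Longrightarrow> f g \<in> M"
    and f_equivariant: "\<And>h g. \<lbrakk>h \<in> M; g \<in> carrier G\<rbrakk> \<Longrightarrow> f (h \<otimes> g) = h \<otimes> f g"
begin

abbreviation "A \<equiv> G\<lparr>carrier := M\<rparr>"

sublocale A: comm_group A
proof -
  interpret H: group A by (rule subgroup_is_group) (rule is_group)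
  show "comm_group A"
    by (rule H.group_comm_groupI) (simp add: commutes)
qed

definition factor :: "'a \<Rightarrow> 'a \<Rightarrow> 'a" where
  "factor g t = f (t \<otimes> g) \<otimes> inv (f t)"

definition rep :: "'a set \<Rightarrow> 'a" where
  "rep C = (SOME t. t \<in> C)"

definition transfer :: "'a \<Rightarrow> 'a" where
  "transfer g = finprod A (\<lambda>C. factor g (rep C)) (rcosets M)"

lemma finite_rcosets: "finite (rcosets M)"
  using finite_carrier rcosets_subset_PowG[OF subgroup_axioms] by (meson finite_Pow_iff finite_subset)

lemma factor_closed: "\<lbrakk>g \<in> carrier G; t \<in> carrier G\<rbrakk> \<Longrightarrow> factor g t \<in> M"
  by (simp add: factor_def f_closed)

lemma factor_coset:
  assumes g: "g \<in> carrier G" and t: "t \<in> carrier G" and h: "h \<in> M"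
  shows "factor g (h \<otimes> t) = factor g t"
proof -
  have "factor g (h \<otimes> t) = h \<otimes> f (t \<otimes> g) \<otimes> (inv (f t) \<otimes> inv h)"
    using assms f_closed by (simp add: factor_def m_assoc f_equivariant inv_mult_group)
  also have "\<dots> = h \<otimes> factor g t \<otimes> inv h"
    using assms f_closed by (simp add: factor_def m_assoc)
  also have "\<dots> = factor g t \<otimes> h \<otimes> inv h"
    using commutes[OF h factor_closed[OF g t]] by simp
  also have "\<dots> = factor g t"
    using factor_closed[OF g t] h by (simp add: m_assoc)
  finally show ?thesis .
qed

lemma rep_in: "C \<in> rcosets M \<Longrightarrow> rep C \<in> C"
  using rcosets_non_empty[of C] by (auto simp: rep_def intro: someI)

lemma rep_carrier: "C \<in> rcosets M \<Longrightarrow> rep C \<in> carrier G"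
  using rep_in rcosets_carrier[OF is_group] by blast

text \<open>This frees calculations from the choice made by \<open>rep\<close>: any element of the
  coset serves.\<close>

lemma factor_rep:
  assumes "C \<in> rcosets M" "t \<in> C" "g \<in> carrier G"
  shows "factor g (rep C) = factor g t"
proof -
  obtain s where s: "s \<in> carrier G" "C = M #> s" using assms(1) by (auto simp: RCOSETS_def)
  then obtain h k where "h \<in> M" "t = h \<otimes> s" "k \<in> M" "rep C = k \<otimes> s"
    using rep_in[OF assms(1)] assms(2) by (auto simp: r_coset_def)
  then show ?thesis using factor_coset[OF assms(3) s(1)] by simp
qed

lemma transfer_closed: "g \<in> carrier G \<Longrightarrow> transfer g \<in> M"
  using A.finprod_closed[of "\<lambda>C. factor g (rep C)" "rcosets M"]
  by (simp add: transfer_def factor_closed rep_carrier Pi_def)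

lemma rcosets_translate:
  assumes a: "a \<in> carrier G"
  shows "(\<lambda>C. C #> a) ` (rcosets M) = rcosets M" and "inj_on (\<lambda>C. C #> a) (rcosets M)"
proof -
  have sub: "C \<subseteq> carrier G" if "C \<in> rcosets M" for C
    using rcosets_subset_PowG[OF subgroup_axioms] that by blast
  show inj: "inj_on (\<lambda>C. C #> a) (rcosets M)"
  proof (rule inj_onI)
    fix C D assume CD: "C \<in> rcosets M" "D \<in> rcosets M" "C #> a = D #> a"
    then have "C #> a #> inv a = D #> a #> inv a" by simp
    then show "C = D" using sub[OF CD(1)] sub[OF CD(2)] a by (simp add: coset_mult_assoc)
  qed
  show "(\<lambda>C. C #> a) ` (rcosets M) = rcosets M"
  proof (rule endo_inj_surj[OF finite_rcosets _ inj])
    show "(\<lambda>C. C #> a) ` (rcosets M) \<subseteq> rcosets M"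
      using a by (auto simp: RCOSETS_def coset_mult_assoc subset)
  qed
qed

text \<open>For a representative \<open>t\<close>, \<open>factor (a b) t\<close> is
  \<open>factor b (t a)\<close> times \<open>factor a t\<close>, and the cosets
  \<open>C #> a\<close> again run through all cosets.\<close>

lemma transfer_mult:
  assumes a: "a \<in> carrier G" and b: "b \<in> carrier G"
  shows "transfer (a \<otimes> b) = transfer a \<otimes> transfer b"
proof -
  have split: "factor (a \<otimes> b) (rep C) = factor b (rep (C #> a)) \<otimes>\<^bsub>A\<^esub> factor a (rep C)"
    if C: "C \<in> rcosets M" for C
  proof -
    note t = rep_carrier[OF C]
    have "C #> a \<in> rcosets M" using rcosets_translate(1)[OF a] C by blast
    moreover have "rep C \<otimes> a \<in> C #> a" using rep_in[OF C] by (auto simp: r_coset_def)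
    ultimately have "factor b (rep (C #> a)) = factor b (rep C \<otimes> a)" using b by (rule factor_rep)
    then show ?thesis
      using t a b f_closed by (simp add: factor_def m_assoc inv_cancel_left)
  qed
  have "transfer (a \<otimes> b) =
      finprod A (\<lambda>C. factor b (rep (C #> a)) \<otimes>\<^bsub>A\<^esub> factor a (rep C)) (rcosets M)"
    unfolding transfer_def using assms rcosets_translate(1)[OF a]
    by (intro A.finprod_cong') (auto simp: split intro!: m_closed factor_closed rep_carrier)
  also have "\<dots> = finprod A (\<lambda>C. factor b (rep (C #> a))) (rcosets M) \<otimes>\<^bsub>A\<^esub> transfer a"
    unfolding transfer_def using assms rcosets_translate(1)[OF a]
    by (intro A.finprod_multf) (auto intro!: factor_closed rep_carrier)
  also have "finprod A (\<lambda>C. factor b (rep (C #> a))) (rcosets M) =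
      finprod A (\<lambda>C. factor b (rep C)) ((\<lambda>C. C #> a) ` (rcosets M))"
    using rcosets_translate[OF a] b
    by (intro A.finprod_reindex[symmetric]) (auto intro!: factor_closed rep_carrier)
  also have "\<dots> = transfer b" by (simp add: rcosets_translate(1)[OF a] transfer_def)
  finally show ?thesis using commutes transfer_closed assms by simp
qed

lemma transfer_hom: "transfer \<in> hom G A"
  by (auto simp: hom_def transfer_closed transfer_mult)

lemma transfer_derived: "g \<in> derived G (carrier G) \<Longrightarrow> transfer g = \<one>"
proof -
  assume g: "g \<in> derived G (carrier G)"
  interpret group_hom G A transfer
    by unfold_locales (rule transfer_hom)
  have "transfer ` derived G (carrier G) = derived A (transfer ` carrier G)"
    by (rule derived_img[symmetric]) simp
  also have "\<dots> = {\<one>\<^bsub>A\<^esub>}"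
    by (rule A.derived_eq_singleton) (auto simp: transfer_closed)
  finally show ?thesis using g by auto
qed

text \<open>A central \<open>y\<close> moves past each representative, and equivariance of
  \<open>f\<close> turns every factor into \<open>y\<close> itself.\<close>

lemma transfer_central:
  assumes y: "y \<in> M" and central: "\<And>g. g \<in> carrier G \<Longrightarrow> y \<otimes> g = g \<otimes> y"
  shows "transfer y = y [^] card (rcosets M)"
proof -
  have "factor y (rep C) = y" if "C \<in> rcosets M" for C
    using rep_carrier[OF that] y f_closed central[of "rep C", symmetric]
    by (simp add: factor_def f_equivariant m_assoc)
  then have "transfer y = finprod A (\<lambda>C. y) (rcosets M)"
    unfolding transfer_def using y by (intro A.finprod_cong') auto
  also have "\<dots> = y [^]\<^bsub>A\<^esub> card (rcosets M)"
    using y by (intro A.finprod_const) simp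
  finally show ?thesis by (simp add: nat_pow_consistent[symmetric])
qed

text \<open>Off \<open>M\<close> right multiplication by \<open>y\<close> leaves \<open>f\<close>
  unchanged, so every coset but \<open>M\<close> contributes a trivial factor, while
  \<open>M\<close> contributes \<open>y\<close>.\<close>

lemma transfer_free:
  assumes y: "y \<in> M" and id: "\<And>h. h \<in> M \<Longrightarrow> f h = h"
    and inv: "\<And>g. g \<in> carrier G - M \<Longrightarrow> f (g \<otimes> y) = f g"
  shows "transfer y = y"
proof -
  have MC: "M \<in> rcosets M" by (rule subgroup_in_rcosets[OF is_group])
  have "factor y (rep C) = (if M = C then y else \<one>\<^bsub>A\<^esub>)" if C: "C \<in> rcosets M" for C
  proof (cases "C = M")
    case True
    then show ?thesis
      using factor_rep[OF MC one_closed, of y] y id by (simp add: factor_def)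
  next
    case False
    then have "C \<inter> M = {}"
      using rcos_disjoint[OF subgroup_axioms] C MC by (auto simp: pairwise_def disjnt_def)
    then have "rep C \<in> carrier G - M"
      using rep_in[OF C] rep_carrier[OF C] by blast
    then show ?thesis
      using False f_closed[of "rep C"] inv[of "rep C"] by (simp add: factor_def)
  qed
  then have "transfer y = finprod A (\<lambda>C. if M = C then y else \<one>\<^bsub>A\<^esub>) (rcosets M)"
    unfolding transfer_def using y by (intro A.finprod_cong') auto
  also have "\<dots> = y"
    using A.finprod_singleton[OF MC finite_rcosets, of "\<lambda>_. y"] y by simp
  finally show ?thesis .
qed

end

subsection \<open>Groups in which every proper subgroup containing a given element is abelian\<close>

definition (in group) centralizer :: "'a \<Rightarrow> 'a set" where
  "centralizer y = {g \<in> carrier G. y \<otimes> g = g \<otimes> y}"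

lemma (in group) subgroup_centralizer:
  assumes y: "y \<in> carrier G"
  shows "subgroup (centralizer y) G"
proof (rule subgroupI)
  fix g assume g: "g \<in> centralizer y"
  then have gG: "g \<in> carrier G" and comm: "g \<otimes> y = y \<otimes> g"
    by (auto simp: centralizer_def)
  have "y \<otimes> inv g = inv g \<otimes> (g \<otimes> y) \<otimes> inv g"
    using gG y by (simp add: m_assoc inv_cancel_left)
  also have "\<dots> = inv g \<otimes> (y \<otimes> g) \<otimes> inv g" by (simp only: comm)
  also have "\<dots> = inv g \<otimes> y" using gG y by (simp add: m_assoc)
  finally show "inv g \<in> centralizer y" using gG by (simp add: centralizer_def)
next
  fix g h assume g: "g \<in> centralizer y" and h: "h \<in> centralizer y"
  then have G: "g \<in> carrier G" "h \<in> carrier G" and comm: "y \<otimes> g = g \<otimes> y" "y \<otimes> h = h \<otimes> y"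
    by (auto simp: centralizer_def)
  have "y \<otimes> (g \<otimes> h) = (y \<otimes> g) \<otimes> h" using G y by (simp add: m_assoc)
  also have "\<dots> = g \<otimes> (y \<otimes> h)" using G y comm(1) by (simp add: m_assoc)
  also have "\<dots> = (g \<otimes> h) \<otimes> y" using G y comm(2) by (simp add: m_assoc)
  finally show "g \<otimes> h \<in> centralizer y" using G by (simp add: centralizer_def)
qed (use y in \<open>auto simp: centralizer_def\<close>)

text \<open>Exponent-criticality enters only through \<open>critical\<close>; \<open>x\<close> is to
  be an element of critical order, moved by conjugation into the Sylow subgroup
  \<open>P\<close>.\<close>

locale critical_sylow = group G for G (structure) +
  fixes p :: nat and P :: "'a set" and x :: 'a
  assumes finite_carrier: "finite (carrier G)"
    and nonabelian: "\<not> commutative_set G (carrier G)"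
    and three_primes: "card (prime_factors (order G)) = 3"
    and p: "Factorial_Ring.prime p"
    and subgroup_P: "subgroup P G"
    and card_P: "card P = p ^ multiplicity p (order G)"
    and x: "x \<in> P"
    and critical: "\<And>H. \<lbrakk>subgroup H G; x \<in> H; H \<noteq> carrier G\<rbrakk> \<Longrightarrow> commutative_set G H"
begin

sublocale P: subgroup P G by (rule subgroup_P)

abbreviation "central y \<equiv> \<forall>g\<in>carrier G. y \<otimes> g = g \<otimes> y"

lemma order_pos: "order G > 0"
  using finite_carrier order_gt_0_iff_finite by blast

text \<open>A product of two prime powers has at most two prime divisors. Through this fact
  \<open>three_primes\<close> keeps \<open>P\<close>, and later the product of \<open>P\<close> with
  a \<open>q\<close>-subgroup, from being all of \<open>G\<close>.\<close>

lemma order_neq: "order G \<noteq> p ^ i * q ^ j" if "Factorial_Ring.prime q"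
proof
  assume "order G = p ^ i * q ^ j"
  moreover have "r = p \<or> r = q" if r: "Factorial_Ring.prime r" "r dvd p ^ i * q ^ j" for r
    using r p \<open>Factorial_Ring.prime q\<close>
    by (meson prime_dvd_mult_iff prime_dvd_power primes_dvd_imp_eq)
  ultimately have "prime_factors (order G) \<subseteq> {p, q}"
    by (auto simp: prime_factors_dvd)
  then have "card (prime_factors (order G)) \<le> card {p, q}"
    by (rule card_mono[rotated]) simp
  also have "\<dots> \<le> 2" by (simp add: card_insert_if)
  finally show False using three_primes by simp
qed

lemma commutative_P:
  assumes "y \<in> P" "z \<in> P"
  shows "y \<otimes> z = z \<otimes> y"
proof -
  have "P \<noteq> carrier G"
    using order_neq[OF p, of "multiplicity p (order G)" 0] card_P by (auto simp: order_def)
  then show ?thesis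
    using critical[OF subgroup_P x] assms by (auto simp: commutative_set_def)
qed

text \<open>As three primes divide the order of \<open>G\<close>, the subgroup generated by \<open>P\<close> and \<open>Q\<close> is proper.\<close>
lemma sylow_commutes:
  assumes q: "Factorial_Ring.prime q" "q \<noteq> p" and Q: "subgroup Q G" and card_Q: "card Q = q ^ j"
    and normalizes: "(\<forall>z\<in>Q. \<forall>y\<in>P. y \<otimes> z \<otimes> inv y \<in> Q) \<or> (\<forall>y\<in>P. \<forall>z\<in>Q. z \<otimes> y \<otimes> inv z \<in> P)"
    and y: "y \<in> P" and z: "z \<in> Q"
  shows "y \<otimes> z = z \<otimes> y"
proof -
  have fin: "finite P" "finite Q"
    using finite_carrier P.subset subgroup.subset[OF Q] finite_subset by auto
  obtain L where L: "subgroup L G" "P \<subseteq> L" "Q \<subseteq> L" "card L \<le> card P * card Q"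
  proof (cases "\<forall>z\<in>Q. \<forall>y\<in>P. y \<otimes> z \<otimes> inv y \<in> Q")
    case True
    then have "subgroup (Q <#> P) G"
      by (intro subgroup_set_mult_normalized[OF Q subgroup_P]) auto
    then show thesis
      using that[of "Q <#> P"] set_mult_contains[OF Q subgroup_P] card_set_mult_le[of Q P G] fin
      by (simp add: mult.commute)
  next
    case False
    then have "subgroup (P <#> Q) G"
      using normalizes by (intro subgroup_set_mult_normalized[OF subgroup_P Q]) auto
    then show thesis
      using that[of "P <#> Q"] set_mult_contains[OF subgroup_P Q] card_set_mult_le[of P Q G] fin
      by simp
  qed
  \<comment> \<open>Both orders divide \<open>order G\<close>, so by coprimality their product does
    too. It differs from \<open>order G\<close> and bounds \<open>card L\<close>, hence
    \<open>L\<close> is proper.\<close>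
  have "coprime (card P) (card Q)"
    using q p by (simp add: card_P card_Q primes_coprime)
  moreover have "card P dvd order G" "card Q dvd order G"
    using card_subgroup_dvd[OF _ subgroup_self] subgroup_P Q P.subset subgroup.subset[OF Q]
    by (auto simp: order_def)
  ultimately have "card P * card Q dvd order G" by (intro divides_mult)
  then have "card P * card Q \<le> order G" using order_pos by (rule dvd_imp_le)
  moreover have "order G \<noteq> card P * card Q" unfolding card_P card_Q by (rule order_neq[OF q(1)])
  ultimately have "L \<noteq> carrier G" using L(4) by (auto simp: order_def)
  then have "commutative_set G L" using critical[OF L(1)] L(2) x by blast
  then show ?thesis using L(2,3) y z by (auto simp: commutative_set_def)
qed

text \<open>For a non-central \<open>y\<close> in \<open>P\<close> this places every proper subgroup
  containing \<open>x\<close> and \<open>y\<close> inside the proper subgroup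
  \<open>centralizer y\<close>.\<close>

lemma subset_centralizerI:
  assumes H: "subgroup H G" "x \<in> H" "H \<noteq> carrier G" and y: "y \<in> H"
  shows "H \<subseteq> centralizer y"
  using critical[OF H] y subgroup.subset[OF H(1)] by (auto simp: commutative_set_def centralizer_def)

text \<open>The centralizer of \<open>y\<close> contains a Sylow subgroup for each prime:
  \<open>P\<close> itself for \<open>p\<close>, because \<open>P\<close> is abelian, and any Sylow
  subgroup for the other primes by \<open>sylow_commutes\<close>.\<close>

lemma normal_imp_central:
  assumes normal: "\<And>g w. \<lbrakk>g \<in> carrier G; w \<in> P\<rbrakk> \<Longrightarrow> g \<otimes> w \<otimes> inv g \<in> P" and y: "y \<in> P"
  shows "central y"
proof -
  have "carrier G \<subseteq> centralizer y"
  proof (rule subset_of_sylow_subsets[OF finite_carrier subgroup_self])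
    show "subgroup (centralizer y) G" using y by (intro subgroup_centralizer) simp
  next
    fix q :: nat assume q: "Factorial_Ring.prime q"
    obtain Q where Q: "subgroup Q G" "card Q = q ^ multiplicity q (order G)"
      and eq: "q = p \<Longrightarrow> Q = P"
      using exists_sylow_subgroup[OF finite_carrier subgroup_self q multiplicity_dvd] subgroup_P card_P
      unfolding order_def by metis
    have "y \<otimes> z = z \<otimes> y" if "z \<in> Q" for z
    proof (cases "q = p")
      case True
      then show ?thesis using eq commutative_P y that by blast
    next
      case False
      then show ?thesis
        using sylow_commutes[OF q _ Q _ y that] normal subgroup.subset[OF Q(1)] by blast
    qed
    then have "Q \<subseteq> centralizer y"
      using subgroup.subset[OF Q(1)] by (auto simp: centralizer_def)
    then show "\<exists>Q. subgroup Q G \<and> Q \<subseteq> carrier G \<and> Q \<subseteq> centralizer y \<and>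
        card Q = q ^ multiplicity q (card (carrier G))"
      using Q subgroup.subset[OF Q(1)] by (auto simp: order_def)
  qed
  then show ?thesis by (auto simp: centralizer_def)
qed

text \<open>The conjugate lies in a \<open>p\<close>-subgroup of \<open>M\<close>, which some
  element of \<open>M\<close> conjugates into the Sylow subgroup \<open>P\<close>. As
  \<open>M\<close> is abelian, this second conjugation moves nothing.\<close>

lemma conjugate_in_P:
  assumes M: "subgroup M G" "commutative_set G M" "P \<subseteq> M" and w: "w \<in> P" and t: "t \<in> carrier G"
    and conj: "t \<otimes> w \<otimes> inv t \<in> M"
  shows "t \<otimes> w \<otimes> inv t \<in> P"
proof -
  interpret M: subgroup M G by (rule M)
  interpret M': group "G\<lparr>carrier := M\<rparr>" by (rule subgroup_imp_group[OF M(1)])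
  define T where "T = (\<lambda>y. t \<otimes> y \<otimes> inv t) ` P"
  have T: "subgroup T G" unfolding T_def by (rule subgroup_conjugate_image[OF subgroup_P t])
  have TM: "subgroup (T \<inter> M) G" by (rule subgroups_Inter_pair[OF T M(1)])
  have "card (T \<inter> M) dvd card T" by (rule card_subgroup_dvd[OF TM T]) simp
  also have "card T = card P" unfolding T_def by (rule card_conjugate_image[OF P.subset t])
  finally obtain k where k: "card (T \<inter> M) = p ^ k"
    using p by (auto simp: card_P divides_primepow_nat)
  have "card M dvd order G" by (simp flip: lagrange[OF M(1)])
  then have "multiplicity p (card M) \<le> multiplicity p (order G)"
    using order_pos by (intro dvd_imp_multiplicity_le) auto
  then have "p ^ multiplicity p (order (G\<lparr>carrier := M\<rparr>)) dvd card P"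
    unfolding card_P by (simp add: order_def le_imp_power_dvd)
  moreover have P': "subgroup P (G\<lparr>carrier := M\<rparr>)" by (rule subgroup_incl[OF subgroup_P M(1) M(3)])
  moreover have fin: "finite (carrier (G\<lparr>carrier := M\<rparr>))"
    using M.subset finite_carrier finite_subset by auto
  ultimately have ndvd: "\<not> p dvd card (rcosets\<^bsub>G\<lparr>carrier := M\<rparr>\<^esub> P)"
    by (intro M'.card_rcosets_not_dvd[OF _ _ p])
  have TM': "subgroup (T \<inter> M) (G\<lparr>carrier := M\<rparr>)" by (rule subgroup_incl[OF TM M(1)]) simp
  obtain m where m: "m \<in> M" "\<And>h. h \<in> T \<inter> M \<Longrightarrow> m \<otimes> h \<otimes> inv m \<in> P"
    using M'.prime_power_subgroup_conjugate[OF fin P' TM' p k ndvd] m_inv_consistent[OF M(1)]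
    by auto
  define v where "v = t \<otimes> w \<otimes> inv t"
  have v: "v \<in> T \<inter> M" using conj w by (auto simp: v_def T_def)
  have "m \<otimes> v \<otimes> inv m = v \<otimes> m \<otimes> inv m" using M(2) v m by (auto simp: commutative_set_def)
  also have "\<dots> = v" using v m by (simp add: m_assoc)
  finally show ?thesis using m(2)[OF v] by (simp add: v_def)
qed

end

section \<open>Refutation of the case that the Sylow subgroup is not central\<close>

locale noncentral_critical_sylow = critical_sylow +
  fixes y0 :: 'a
  assumes y0: "y0 \<in> P" and not_central: "\<not> central y0"
begin

definition "M = centralizer y0"

lemma subgroup_M: "subgroup M G"
  unfolding M_def by (rule subgroup_centralizer) (rule P.mem_carrier[OF y0])

lemma P_sub_M: "P \<subseteq> M"
  using commutative_P y0 by (auto simp: M_def centralizer_def)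

lemma commutative_M: "commutative_set G M"
proof (rule critical[OF subgroup_M])
  show "x \<in> M" using x P_sub_M by blast
  show "M \<noteq> carrier G" using not_central by (auto simp: M_def centralizer_def)
qed

lemma not_normal: "\<not> (\<forall>g\<in>carrier G. \<forall>w\<in>P. g \<otimes> w \<otimes> inv g \<in> P)"
  using normal_imp_central y0 not_central by blast

text \<open>\<open>M\<close> is the only maximal subgroup above \<open>P\<close>, so the normalizer of \<open>P\<close> is \<open>M\<close> and distinct
  conjugates of \<open>M\<close> meet in the center.\<close>
lemma conjugate_notin_M:
  assumes w: "w \<in> P" "\<not> central w" and t: "t \<in> carrier G - M"
  shows "t \<otimes> w \<otimes> inv t \<notin> M"
proof
  interpret M: subgroup M G by (rule subgroup_M)
  assume conj: "t \<otimes> w \<otimes> inv t \<in> M"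
  have G: "t \<in> carrier G" "w \<in> carrier G" using t w by auto
  \<comment> \<open>\<open>P\<close> is abelian, so \<open>centralizer w\<close> contains
    \<open>x\<close> and \<open>y0\<close>; being proper, it lies in the centralizer of
    \<open>y0\<close>.\<close>
  have "centralizer w \<subseteq> centralizer y0"
  proof (rule subset_centralizerI)
    show "subgroup (centralizer w) G" using w by (intro subgroup_centralizer) simp
    show "x \<in> centralizer w" "y0 \<in> centralizer w"
      using w x y0 commutative_P by (auto simp: centralizer_def)
    show "centralizer w \<noteq> carrier G" using w(2) by (auto simp: centralizer_def)
  qed
  then have CM: "centralizer w \<subseteq> M" by (simp add: M_def)
  \<comment> \<open>Conjugating by \<open>inv t\<close> the fact that \<open>m\<close> commutes with
    \<open>t w inv t\<close> shows that \<open>inv t m t\<close> centralizes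
    \<open>w\<close>.\<close>
  have inv_conj: "inv t \<otimes> m \<otimes> t \<in> M" if m: "m \<in> M" for m
  proof -
    have "m \<otimes> (t \<otimes> w \<otimes> inv t) = (t \<otimes> w \<otimes> inv t) \<otimes> m"
      using commutative_M m conj by (auto simp: commutative_set_def)
    then have "inv t \<otimes> (m \<otimes> (t \<otimes> w \<otimes> inv t)) \<otimes> t = inv t \<otimes> ((t \<otimes> w \<otimes> inv t) \<otimes> m) \<otimes> t"
      by simp
    then have "w \<otimes> (inv t \<otimes> m \<otimes> t) = (inv t \<otimes> m \<otimes> t) \<otimes> w"
      using G m by (simp add: m_assoc inv_cancel_left)
    then show ?thesis using CM G m by (auto simp: centralizer_def)
  qed
  \<comment> \<open>This is the normalizer of \<open>P\<close>, since in a finite group inclusion of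
    the conjugate already means equality. It is proper and contains \<open>x\<close> and
    \<open>y0\<close>, so it lies in \<open>M\<close>.\<close>
  define N where "N = {g \<in> carrier G. \<forall>w\<in>P. g \<otimes> w \<otimes> inv g \<in> P}"
  have N: "subgroup N G"
  proof (rule finite_subgroupI[OF finite_carrier])
    fix a b assume "a \<in> N" "b \<in> N"
    then show "a \<otimes> b \<in> N" by (auto simp: N_def conjugate_mult)
  qed (auto simp: N_def)
  have MN: "M \<subseteq> N"
  proof
    fix m assume m: "m \<in> M"
    have "m \<otimes> u \<otimes> inv m = u" if "u \<in> P" for u
    proof -
      have "m \<otimes> u = u \<otimes> m" using commutative_M m that P_sub_M by (auto simp: commutative_set_def)
      then show ?thesis using m that by (simp add: m_assoc)
    qed
    then show "m \<in> N" using m by (auto simp: N_def)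
  qed
  \<comment> \<open>Conjugation by \<open>inv t\<close> carries \<open>P\<close> into
    \<open>M\<close> and therefore into \<open>P\<close>, which puts \<open>inv t\<close> into
    \<open>N\<close>.\<close>
  have "inv t \<otimes> u \<otimes> inv (inv t) \<in> P" if "u \<in> P" for u
    using that P_sub_M inv_conj[of u] G
    by (intro conjugate_in_P[OF M.subgroup_axioms commutative_M]) auto
  then have tN: "inv t \<in> N" using G by (auto simp: N_def)
  have "N \<noteq> carrier G" using not_normal by (auto simp: N_def)
  then have "N \<subseteq> M"
    unfolding M_def using N MN P_sub_M x y0 by (intro subset_centralizerI) auto
  then have "inv (inv t) \<in> M" using tN by blast
  then show False using t by auto
qed

text \<open>A subgroup of order \<open>p\<close> in the derived subgroup can be conjugated into
  \<open>P\<close>; let \<open>y\<close> generate the result. The transfer into \<open>M\<close>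
  kills \<open>y\<close>. Yet it maps \<open>y\<close> to a power with exponent prime to
  \<open>p\<close> if \<open>y\<close> is central, and to \<open>y\<close> itself if not.\<close>

lemma prime_not_dvd_derived: "\<not> p dvd card (derived G (carrier G))"
proof
  let ?K = "derived G (carrier G)"
  interpret K: normal ?K G by (rule derived_self_is_normal)
  interpret M: subgroup M G by (rule subgroup_M)
  assume "p dvd card ?K"
  then obtain S where S: "subgroup S G" "S \<subseteq> ?K" "card S = p ^ 1"
    using exists_sylow_subgroup[OF finite_carrier K.subgroup_axioms p, of 1] by auto
  have ndvd: "\<not> p dvd card (rcosets P)"
    using card_rcosets_not_dvd[OF finite_carrier subgroup_P p] card_P by simp
  obtain g where g: "g \<in> carrier G" "\<And>h. h \<in> S \<Longrightarrow> g \<otimes> h \<otimes> inv g \<in> P"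
    using prime_power_subgroup_conjugate[OF finite_carrier subgroup_P S(1) p S(3) ndvd] by blast
  define Y where "Y = (\<lambda>h. g \<otimes> h \<otimes> inv g) ` S"
  have Y: "subgroup Y G" unfolding Y_def by (rule subgroup_conjugate_image[OF S(1) g(1)])
  have YP: "Y \<subseteq> P" using g by (auto simp: Y_def)
  have YK: "Y \<subseteq> ?K" using g(1) S(2) K.inv_op_closed2 by (auto simp: Y_def)
  have cardY: "card Y = p"
    unfolding Y_def using card_conjugate_image[OF subgroup.subset[OF S(1)] g(1)] S(3) by simp
  have sub: "H = {\<one>} \<or> H = Y" if H: "subgroup H G" "H \<subseteq> Y" for H
  proof -
    have "card H dvd p" using card_subgroup_dvd[OF H(1) Y H(2)] cardY by simp
    then consider "card H = 1" | "card H = p" using p prime_nat_iff by blast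
    then show ?thesis
    proof cases
      case 1
      then show ?thesis using subgroup.one_closed[OF H(1)] by (auto simp: card_1_singleton_iff)
    next
      case 2
      then show ?thesis
        using H(2) cardY subgroup.subset[OF Y] finite_carrier finite_subset
        by (metis card_subset_eq)
    qed
  qed
  have "Y \<noteq> {\<one>}" using cardY p by (auto simp: prime_nat_iff)
  then obtain y where y: "y \<in> Y" "y \<noteq> \<one>" using subgroup.one_closed[OF Y] by blast
  have yG: "y \<in> carrier G" using y YP by auto
  have "generate G {y} = Y"
    using sub[OF generate_is_subgroup generate_subgroup_incl[OF _ Y]] y yG generate.incl[of y "{y}" G]
    by auto
  then have ord_y: "ord y = p" using generate_pow_card[OF yG] cardY by simp
  have YM: "Y \<subseteq> M" using YP P_sub_M by blast
  have yM: "y \<in> M" and yK: "y \<in> ?K" using y(1) YM YK by auto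
  show False
  proof (cases "central y")
    case True
    obtain f where f: "f \<in> carrier G \<rightarrow> M" "\<forall>h\<in>M. \<forall>g\<in>carrier G. f (h \<otimes> g) = h \<otimes> f g"
      using exists_coset_equivariant_map[OF M.subgroup_axioms triv_subgroup] M.one_closed by auto
    interpret abelian_transfer G M f
      using finite_carrier commutative_M f by unfold_locales (auto simp: commutative_set_def)
    have "y [^] card (rcosets M) = \<one>"
      using transfer_central[OF yM] transfer_derived[OF yK] True by simp
    then have "p dvd card (rcosets M)" using pow_eq_id[OF yG] ord_y by simp
    moreover have "card P dvd card M" by (rule card_subgroup_dvd[OF subgroup_P M.subgroup_axioms P_sub_M])
    ultimately show False
      using card_rcosets_not_dvd[OF finite_carrier M.subgroup_axioms p] card_P by simp
  next
    case False
    \<comment> \<open>As \<open>Y\<close> has prime order and \<open>y\<close> is not central, only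
      the identity of \<open>Y\<close> is central. So \<open>conjugate_notin_M\<close> supplies the
      hypothesis \<open>free\<close> for \<open>Y\<close>.\<close>
    define Z where "Z = {z \<in> Y. central z}"
    have "subgroup Z G"
    proof (rule finite_subgroupI[OF finite_carrier])
      fix a b assume ab: "a \<in> Z" "b \<in> Z"
      then have G: "a \<in> carrier G" "b \<in> carrier G" using YP by (auto simp: Z_def)
      have "a \<otimes> b \<otimes> g = g \<otimes> (a \<otimes> b)" if g: "g \<in> carrier G" for g
      proof -
        have "a \<otimes> b \<otimes> g = a \<otimes> (b \<otimes> g)" using G g by (simp add: m_assoc)
        also have "\<dots> = a \<otimes> (g \<otimes> b)" using ab g by (simp add: Z_def)
        also have "\<dots> = a \<otimes> g \<otimes> b" using G g by (simp add: m_assoc)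
        also have "\<dots> = g \<otimes> a \<otimes> b" using ab g by (simp add: Z_def)
        finally show ?thesis using G g by (simp add: m_assoc)
      qed
      then show "a \<otimes> b \<in> Z" using ab subgroup.m_closed[OF Y] by (simp add: Z_def)
    qed (use YP subgroup.one_closed[OF Y] in \<open>auto simp: Z_def\<close>)
    then have Z: "Z = {\<one>}" using sub[of Z] False y by (auto simp: Z_def)
    have "u = \<one>" if "r \<in> carrier G - M" "u \<in> Y" "r \<otimes> u \<otimes> inv r \<in> M" for r u
      using conjugate_notin_M[of u r] that YP Z by (auto simp: Z_def)
    then obtain f where f: "f \<in> carrier G \<rightarrow> M" "\<forall>h\<in>M. \<forall>g\<in>carrier G. f (h \<otimes> g) = h \<otimes> f g"
      "\<forall>h\<in>M. f h = h" "\<forall>g\<in>carrier G - M. \<forall>u\<in>Y. f (g \<otimes> u) = f g"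
      using exists_coset_equivariant_map[OF M.subgroup_axioms Y YM] by blast
    interpret abelian_transfer G M f
      using finite_carrier commutative_M f by unfold_locales (auto simp: commutative_set_def)
    have "y = \<one>"
      using transfer_free[OF yM] transfer_derived[OF yK] f y(1) by simp
    then show False using y by simp
  qed
qed

lemma contradiction: False
proof -
  let ?K = "derived G (carrier G)"
  interpret K: normal ?K G by (rule derived_self_is_normal)
  interpret M: subgroup M G by (rule subgroup_M)
  have "?K \<subseteq> M"
  proof (rule subset_of_sylow_subsets[OF finite_carrier K.subgroup_axioms M.subgroup_axioms])
    fix q :: nat assume q: "Factorial_Ring.prime q" "q dvd card ?K"
    then have "q \<noteq> p" using prime_not_dvd_derived by blast
    obtain Q where Q: "subgroup Q G" "Q \<subseteq> ?K" "card Q = q ^ multiplicity q (card ?K)"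
      "\<forall>z\<in>Q. \<forall>y\<in>P. y \<otimes> z \<otimes> inv y \<in> Q"
      using exists_invariant_sylow_subgroup[OF finite_carrier derived_self_is_normal subgroup_P p card_P
          prime_not_dvd_derived q(1)] by blast
    have "z \<in> M" if z: "z \<in> Q" for z
    proof -
      have "y0 \<otimes> z = z \<otimes> y0"
        by (rule sylow_commutes[OF q(1) \<open>q \<noteq> p\<close> Q(1,3) _ y0 z]) (use Q(4) in blast)
      then show ?thesis
        using subgroup.mem_carrier[OF Q(1) z] unfolding M_def centralizer_def by blast
    qed
    with Q show "\<exists>Q. subgroup Q G \<and> Q \<subseteq> ?K \<and> Q \<subseteq> M \<and> card Q = q ^ multiplicity q (card ?K)"
      by blast
  qed
  have "g \<otimes> w \<otimes> inv g \<in> P" if g: "g \<in> carrier G" and w: "w \<in> P" for g w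
  proof (rule conjugate_in_P[OF M.subgroup_axioms commutative_M P_sub_M w g])
    \<comment> \<open>A conjugate of \<open>w\<close> is a commutator times \<open>w\<close>, and
      both factors lie in \<open>M\<close>.\<close>
    have "g \<otimes> w \<otimes> inv g \<otimes> inv w \<in> ?K"
      unfolding derived_def using g P.mem_carrier[OF w] by (intro generate.incl) blast
    then have "g \<otimes> w \<otimes> inv g \<otimes> inv w \<otimes> w \<in> M"
      using \<open>?K \<subseteq> M\<close> w P_sub_M by blast
    then show "g \<otimes> w \<otimes> inv g \<in> M" using g w by (simp add: m_assoc)
  qed
  then show False using not_normal by blast
qed

end

section \<open>Centrality of the Sylow subgroup and the direct decomposition\<close>

lemma (in critical_sylow) central_P:
  assumes y: "y \<in> P" and g: "g \<in> carrier G"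
  shows "y \<otimes> g = g \<otimes> y"
proof (rule ccontr)
  assume "y \<otimes> g \<noteq> g \<otimes> y"
  then interpret noncentral_critical_sylow G p P x y
    using y g by unfold_locales auto
  show False by (rule contradiction)
qed

text \<open>On the central subgroup \<open>P\<close> the transfer is the power map to the index of
  \<open>P\<close>, which is prime to \<open>p\<close>. So it permutes \<open>P\<close>, and its
  kernel is a complement.\<close>

lemma (in critical_sylow) central_complement:
  "\<exists>K. internal_direct_product G P K"
proof -
  obtain f where f: "f \<in> carrier G \<rightarrow> P" "\<forall>h\<in>P. \<forall>g\<in>carrier G. f (h \<otimes> g) = h \<otimes> f g"
    using exists_coset_equivariant_map[OF subgroup_P triv_subgroup] P.one_closed by auto
  interpret T: abelian_transfer G P f
    using finite_carrier commutative_P f by unfold_locales auto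
  interpret T': group_hom G T.A T.transfer by unfold_locales (rule T.transfer_hom)
  let ?n = "card (rcosets P)"
  have ndvd: "\<not> p dvd ?n"
    using card_rcosets_not_dvd[OF finite_carrier subgroup_P p] card_P by simp
  have transfer_P: "T.transfer y = y [^] ?n" if "y \<in> P" for y
    by (rule T.transfer_central[OF that central_P[OF that]])
  have trivial: "y = \<one>" if y: "y \<in> P" "T.transfer y = \<one>" for y
  proof -
    have yG: "y \<in> carrier G" using y by simp
    have "ord y dvd ?n" using y transfer_P pow_eq_id[OF yG] by simp
    moreover have "ord y dvd card P"
      using card_subgroup_dvd[OF generate_is_subgroup subgroup_P generate_subgroup_incl[OF _ subgroup_P]]
        y(1) generate_pow_card[OF yG] by auto
    moreover have "coprime ?n (card P)"
      unfolding card_P using ndvd p by (simp add: prime_imp_coprime coprime_commute)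
    ultimately have "ord y = 1" by (metis coprime_common_divisor_nat nat_dvd_1_iff_1 coprime_def)
    then show ?thesis using ord_eq_1[OF yG] by simp
  qed
  define K where "K = kernel G T.A T.transfer"
  have K: "subgroup K G" unfolding K_def by (rule T'.subgroup_kernel)
  have "inj_on T.transfer P"
  proof (rule inj_onI)
    fix y z assume yz: "y \<in> P" "z \<in> P" "T.transfer y = T.transfer z"
    have "T.transfer (y \<otimes> inv z) = T.transfer y \<otimes> T.transfer (inv z)"
      using yz by (intro T.transfer_mult) auto
    also have "\<dots> = T.transfer (z \<otimes> inv z)"
      unfolding yz(3) using yz by (intro T.transfer_mult[symmetric]) auto
    also have "z \<otimes> inv z = \<one>" using yz by simp
    also have "T.transfer \<one> = \<one>" using T'.hom_one by simp
    finally have "y \<otimes> inv z = \<one>" by (rule trivial[rotated]) (simp add: yz(1,2))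
    then show "y = z" using inv_equality[of y "inv z"] yz(1,2) by simp
  qed
  moreover have "T.transfer ` P \<subseteq> P" using T.transfer_closed by auto
  ultimately have surj: "T.transfer ` P = P"
    using finite_carrier P.subset finite_subset by (intro endo_inj_surj) auto
  have "P \<inter> K = {\<one>}"
    using trivial P.one_closed subgroup.one_closed[OF K] by (auto simp: K_def kernel_def)
  moreover have "P <#> K = carrier G"
  proof
    show "P <#> K \<subseteq> carrier G" using subgroup.subset[OF K] P.subset by (intro set_mult_closed)
    show "carrier G \<subseteq> P <#> K"
    proof
      fix g assume g: "g \<in> carrier G"
      \<comment> \<open>Dividing \<open>g\<close> by the element of \<open>P\<close> with the same
        transfer leaves an element of the kernel.\<close>
      have "T.transfer g \<in> T.transfer ` P" using surj T.transfer_closed[OF g] by simp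
      then obtain y where y: "y \<in> P" "T.transfer g = T.transfer y" by blast
      have "T.transfer (inv y \<otimes> g) = T.transfer (inv y) \<otimes> T.transfer g"
        using y g by (intro T.transfer_mult) auto
      also have "\<dots> = T.transfer (inv y \<otimes> y)"
        unfolding y(2) using y(1) by (intro T.transfer_mult[symmetric]) auto
      also have "inv y \<otimes> y = \<one>" using y by simp
      also have "T.transfer \<one> = \<one>" using T'.hom_one by simp
      finally have "inv y \<otimes> g \<in> K" using y g by (simp add: K_def kernel_def)
      moreover have "g = y \<otimes> (inv y \<otimes> g)" using y g by (simp add: inv_cancel_left)
      ultimately show "g \<in> P <#> K" using y unfolding set_mult_def by blast
    qed
  qed
  moreover have "y \<otimes> k = k \<otimes> y" if "y \<in> P" "k \<in> K" for y k
    using central_P[OF that(1) subgroup.mem_carrier[OF K that(2)]] .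
  ultimately have "internal_direct_product G P K"
    using subgroup_P K unfolding internal_direct_product_def by blast
  then show ?thesis by blast
qed

lemma (in critical_sylow) direct_product_structure:
  "cyclic_subgroup G P \<and> (\<exists>K. internal_direct_product G P K \<and> minimal_nonabelian_subgroup G K)"
proof -
  obtain K where PK: "internal_direct_product G P K" using central_complement by blast
  then have K: "subgroup K G" and disj: "P \<inter> K = {\<one>}" and prod: "P <#> K = carrier G"
    by (auto simp: internal_direct_product_def)
  interpret K: subgroup K G by (rule K)
  have xG: "x \<in> carrier G" using x by simp
  have decomp: "\<exists>u\<in>P. \<exists>k\<in>K. g = u \<otimes> k" if "g \<in> carrier G" for g
    using that prod unfolding set_mult_def by blast
  \<comment> \<open>\<open>P\<close> meets \<open>K\<close> trivially, so an element of
    \<open>K\<close> has no component in \<open>P\<close>.\<close>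
  have unique: "k \<in> H" if "k \<in> K" "H \<subseteq> K" "subgroup H G" "k \<in> P <#> H" for k H
  proof -
    obtain u h where uh: "u \<in> P" "h \<in> H" "k = u \<otimes> h" using \<open>k \<in> P <#> H\<close> unfolding set_mult_def by blast
    have "k \<otimes> inv h = u" using uh subgroup.mem_carrier[OF that(3)] by (simp add: m_assoc)
    moreover have "k \<otimes> inv h \<in> K" using that uh(2) by auto
    ultimately have "u = \<one>" using uh(1) disj by auto
    then show ?thesis using uh subgroup.mem_carrier[OF that(3)] by simp
  qed
  have subgroup_prod: "subgroup (U <#> H) G" if "subgroup U G" "U \<subseteq> P" "subgroup H G" for U H
  proof (rule subgroup_set_mult_normalized[OF that(1,3)])
    fix a b assume "a \<in> U" "b \<in> H"
    then have ab: "a \<in> U" "a \<in> P" "b \<in> carrier G" using that subgroup.subset by auto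
    then have "b \<otimes> a = a \<otimes> b" by (metis central_P)
    then show "b \<otimes> a \<otimes> inv b \<in> U" using ab by (simp add: m_assoc)
  qed
  have nonabelian_K: "\<not> commutative_set G K"
  proof
    assume comm: "commutative_set G K"
    have "g \<otimes> h = h \<otimes> g" if gh: "g \<in> carrier G" "h \<in> carrier G" for g h
    proof -
      obtain u k where uk: "u \<in> P" "k \<in> K" "g = u \<otimes> k" using decomp gh by blast
      obtain v l where vl: "v \<in> P" "l \<in> K" "h = v \<otimes> l" using decomp gh by blast
      have c: "k \<otimes> l = l \<otimes> k" using comm uk vl by (auto simp: commutative_set_def)
      have "g \<otimes> h = u \<otimes> (h \<otimes> k)"
      proof -
        have "k \<otimes> h = h \<otimes> k"
        proof -
          have "k \<otimes> h = (k \<otimes> v) \<otimes> l" using uk vl by (simp add: m_assoc)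
          also have "k \<otimes> v = v \<otimes> k" using central_P[OF vl(1), of k] uk by simp
          also have "v \<otimes> k \<otimes> l = h \<otimes> k" using uk vl c by (simp add: m_assoc)
          finally show ?thesis .
        qed
        then show ?thesis using uk gh by (simp add: m_assoc)
      qed
      also have "\<dots> = (u \<otimes> h) \<otimes> k" using uk gh by (simp add: m_assoc)
      also have "u \<otimes> h = h \<otimes> u" using central_P[OF uk(1) gh(2)] by simp
      also have "h \<otimes> u \<otimes> k = h \<otimes> g" using uk gh by (simp add: m_assoc)
      finally show ?thesis .
    qed
    then show False using nonabelian by (auto simp: commutative_set_def)
  qed
  let ?X = "generate G {x}"
  have X: "subgroup ?X G" by (rule generate_is_subgroup) (simp add: xG)
  have XP: "?X \<subseteq> P" using x by (intro generate_subgroup_incl[OF _ subgroup_P]) auto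
  have xX: "x \<in> ?X" by (rule generate.incl) simp
  have XK: "subgroup (?X <#> K) G" by (rule subgroup_prod[OF X XP K])
  have "?X <#> K = carrier G"
  proof (rule ccontr)
    assume "?X <#> K \<noteq> carrier G"
    then have "commutative_set G (?X <#> K)"
      using critical[OF XK] set_mult_contains(1)[OF X K] xX by blast
    then show False
      using nonabelian_K set_mult_contains(2)[OF X K] by (auto simp: commutative_set_def)
  qed
  have "P \<subseteq> ?X"
  proof
    fix w assume w: "w \<in> P"
    then have "w \<in> ?X <#> K" using \<open>?X <#> K = carrier G\<close> by simp
    then obtain u k where uk: "u \<in> ?X" "k \<in> K" "w = u \<otimes> k" unfolding set_mult_def by blast
    have u: "u \<in> P" using uk XP by blast
    then have "inv u \<otimes> w = k" using uk by (simp add: inv_cancel_left)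
    moreover have "inv u \<otimes> w \<in> P" using u w by simp
    ultimately have "k = \<one>" using disj uk(2) by auto
    then show "w \<in> ?X" using uk u by simp
  qed
  then have "cyclic_subgroup G P"
    using XP xG by (auto simp: cyclic_subgroup_def)
  moreover have "commutative_set G L" if L: "subgroup L G" "L \<subseteq> K" "L \<noteq> K" for L
  proof -
    have PL: "subgroup (P <#> L) G" using subgroup_prod[OF subgroup_P _ L(1)] by simp
    \<comment> \<open>Otherwise all of \<open>K\<close> would lie in \<open>P <#> L\<close> and so,
      by \<open>unique\<close>, in \<open>L\<close>.\<close>
    have "P <#> L \<noteq> carrier G"
      using unique[OF _ L(2,1)] L(2,3) K.subset by blast
    then have "commutative_set G (P <#> L)"
      using critical[OF PL] set_mult_contains(1)[OF subgroup_P L(1)] x by blast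
    then show ?thesis
      using set_mult_contains(2)[OF subgroup_P L(1)] by (auto simp: commutative_set_def)
  qed
  ultimately show ?thesis
    using PK K nonabelian_K unfolding minimal_nonabelian_subgroup_def by blast
qed

subsection \<open>Exponents\<close>

text \<open>The multiplicity of \<open>p\<close> in a least common multiple is the maximum of the
  multiplicities. For empty \<open>S\<close> the \<open>Lcm\<close> is 1, which \<open>a > 0\<close>
  rules out.\<close>

lemma prime_power_dvd_Lcm:
  fixes S :: "nat set"
  assumes "finite S" and p: "Factorial_Ring.prime p" and "a > 0" and "p ^ a dvd Lcm S" and "Lcm S \<noteq> 0"
  shows "\<exists>s\<in>S. p ^ a dvd s"
  using assms(1,4,5)
proof (induction S rule: finite_induct)
  case empty
  then show ?case using p \<open>a > 0\<close> by (auto simp: prime_nat_iff)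
next
  case (insert s S)
  then have nz: "s \<noteq> 0" "Lcm S \<noteq> 0" by auto
  have "a \<le> multiplicity p (lcm s (Lcm S))"
    using insert.prems p nz by (intro multiplicity_geI) auto
  also have "\<dots> = max (multiplicity p s) (multiplicity p (Lcm S))"
    using nz p by (intro multiplicity_lcm) auto
  finally have "p ^ a dvd s \<or> p ^ a dvd Lcm S"
    by (metis le_max_iff_disj multiplicity_dvd')
  then show ?case using insert nz by auto
qed

context group
begin

lemma grp_exp_nonzero:
  assumes fin: "finite (carrier G)" and H: "H \<subseteq> carrier G"
  shows "grp_exp G H \<noteq> 0"
proof -
  have "finite (ord ` H)" using fin H finite_subset by blast
  moreover have "0 \<notin> ord ` H" using H ord_ge_1[OF fin] by force
  ultimately show ?thesis by (simp add: grp_exp_def Lcm_0_iff)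
qed

lemma Lcm_proper_nonabelian_dvd:
  "Lcm {grp_exp G H | H. subgroup H G \<and> H \<noteq> carrier G \<and> \<not> commutative_set G H} dvd grp_exp G (carrier G)"
  unfolding grp_exp_def
  by (rule Lcm_least) (auto intro!: Lcm_subset dest: subgroup.subset)

text \<open>The two least common multiples differ in their multiplicity at some prime
  \<open>p\<close>, and \<open>p ^ a\<close> is the full \<open>p\<close>-part of the exponent of
  \<open>G\<close>. The conclusion covers all elements of order \<open>p ^ a\<close>, so it applies
  to conjugates of \<open>y\<close> as well.\<close>

lemma exponent_critical_witness:
  assumes fin: "finite (carrier G)" and crit: "exponent_critical G"
  obtains p a y where "Factorial_Ring.prime p" "a > 0" "y \<in> carrier G" "ord y = p ^ a"
    "\<And>H z. \<lbrakk>subgroup H G; H \<noteq> carrier G; z \<in> H; ord z = p ^ a\<rbrakk> \<Longrightarrow> commutative_set G H"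
proof -
  let ?L = "Lcm {grp_exp G H | H. subgroup H G \<and> H \<noteq> carrier G \<and> \<not> commutative_set G H}"
  let ?e = "grp_exp G (carrier G)"
  have e: "?e \<noteq> 0" by (rule grp_exp_nonzero[OF fin]) simp
  have L: "?L \<noteq> 0" using e Lcm_proper_nonabelian_dvd by fastforce
  have "\<not> ?e dvd ?L"
    using crit Lcm_proper_nonabelian_dvd dvd_antisym unfolding exponent_critical_def by blast
  then obtain p where p: "Factorial_Ring.prime p" and less: "multiplicity p ?L < multiplicity p ?e"
    using multiplicity_le_imp_dvd[OF e] by (meson not_le)
  define a where "a = multiplicity p ?e"
  have a: "a > 0" using less by (simp add: a_def)
  have "p ^ a dvd Lcm (ord ` carrier G)"
    unfolding a_def grp_exp_def by (rule multiplicity_dvd)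
  then obtain z where z: "z \<in> carrier G" "p ^ a dvd ord z"
    using prime_power_dvd_Lcm[OF _ p a] fin e unfolding grp_exp_def by blast
  \<comment> \<open>The order of \<open>z\<close> is only a multiple of \<open>p ^ a\<close>;
    raising \<open>z\<close> to the cofactor makes it exact.\<close>
  define y where "y = z [^] (ord z div p ^ a)"
  have ordz: "ord z > 0" using ord_ge_1[OF fin z(1)] by simp
  obtain m where m: "ord z = p ^ a * m" using z(2) by blast
  have ppos: "p ^ a > 0" using p by (simp add: prime_gt_0_nat)
  have "ord y = ord z div m"
    using z(1) m ordz ppos unfolding y_def by (subst ord_pow) auto
  then have ordy: "ord y = p ^ a" using m ordz by simp
  have "commutative_set G H"
    if H: "subgroup H G" "H \<noteq> carrier G" "w \<in> H" "ord w = p ^ a" for H w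
  proof (rule ccontr)
    assume "\<not> commutative_set G H"
    then have "grp_exp G H dvd ?L" using H by (intro dvd_Lcm) blast
    moreover have "p ^ a dvd grp_exp G H"
      unfolding grp_exp_def H(4)[symmetric] using H(3) by (intro dvd_Lcm) blast
    ultimately have "p ^ a dvd ?L" by (rule dvd_trans[rotated])
    then have "a \<le> multiplicity p ?L" using L p by (intro multiplicity_geI) auto
    then show False using less by (simp add: a_def)
  qed
  then show thesis using that[OF p a _ ordy] z(1) by (simp add: y_def)
qed

lemma ord_conjugate:
  assumes "g \<in> carrier G" "y \<in> carrier G"
  shows "ord (g \<otimes> y \<otimes> inv g) = ord y"
proof -
  have pow: "(g \<otimes> y \<otimes> inv g) [^] n = g \<otimes> y [^] n \<otimes> inv g" for n :: nat
    using assms by (induction n) (simp_all add: m_assoc inv_cancel_left)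
  have "g \<otimes> y [^] n \<otimes> inv g = \<one> \<longleftrightarrow> y [^] n = \<one>" for n :: nat
  proof
    assume "g \<otimes> y [^] n \<otimes> inv g = \<one>"
    then have "inv g \<otimes> (g \<otimes> y [^] n \<otimes> inv g) \<otimes> g = inv g \<otimes> \<one> \<otimes> g" by simp
    then show "y [^] n = \<one>" using assms by (simp add: m_assoc inv_cancel_left)
  qed (use assms in simp)
  then show ?thesis
    using assms by (simp add: ord_unique pow pow_eq_id)
qed

text \<open>The critical element \<open>y\<close> need not lie in the chosen Sylow subgroup, but the
  group it generates can be conjugated into it, and conjugation keeps the order
  \<open>p ^ a\<close>.\<close>

lemma exponent_critical_imp_direct_product:
  assumes fin: "finite (carrier G)" and nonab: "\<not> commutative_set G (carrier G)"
    and three: "card (prime_factors (order G)) = 3" and crit: "exponent_critical G"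
  shows "\<exists>p P K. sylow_subgroup G p P \<and> cyclic_subgroup G P \<and>
    internal_direct_product G P K \<and> minimal_nonabelian_subgroup G K"
proof -
  obtain p a y where p: "Factorial_Ring.prime p" and a: "a > 0" and y: "y \<in> carrier G" "ord y = p ^ a"
    and abelian: "\<And>H z. \<lbrakk>subgroup H G; H \<noteq> carrier G; z \<in> H; ord z = p ^ a\<rbrakk> \<Longrightarrow> commutative_set G H"
    using exponent_critical_witness[OF fin crit] by metis
  obtain P where P: "subgroup P G" "card P = p ^ multiplicity p (order G)"
    using exists_sylow_subgroup[OF fin subgroup_self p multiplicity_dvd] by (auto simp: order_def)
  have Y: "subgroup (generate G {y}) G" using y by (intro generate_is_subgroup) simp
  have cardY: "card (generate G {y}) = p ^ a" using generate_pow_card[OF y(1)] y(2) by simp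
  have "\<not> p dvd card (rcosets P)" using card_rcosets_not_dvd[OF fin P(1) p] P(2) by simp
  then obtain g where g: "g \<in> carrier G" "\<And>h. h \<in> generate G {y} \<Longrightarrow> g \<otimes> h \<otimes> inv g \<in> P"
    using prime_power_subgroup_conjugate[OF fin P(1) Y p cardY] by blast
  define x where "x = g \<otimes> y \<otimes> inv g"
  have xP: "x \<in> P" unfolding x_def by (intro g(2) generate.incl) simp
  have ordx: "ord x = p ^ a" using ord_conjugate[OF g(1) y(1)] y(2) by (simp add: x_def)
  interpret critical_sylow G p P x
    using fin nonab three p P xP abelian[OF _ _ _ ordx]
    by (intro critical_sylow.intro critical_sylow_axioms.intro is_group) auto
  have "p dvd order G"
    using ord_dvd_group_order[OF y(1)] y(2) a by (metis dvd_power dvd_trans)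
  then have "sylow_subgroup G p P" using p P by (simp add: sylow_subgroup_def)
  then show ?thesis using direct_product_structure by blast
qed

text \<open>If the exponents agreed, \<open>card P\<close>, the order of a generator of
  \<open>P\<close>, would divide the exponent of a proper non-abelian \<open>H\<close>, hence the
  order of some element of \<open>H\<close>. This forces \<open>P\<close> into \<open>H\<close>, and
  then \<open>H\<close> is abelian after all.\<close>

lemma direct_product_imp_exponent_critical:
  assumes fin: "finite (carrier G)" and sylow: "sylow_subgroup G p P" and cyclic: "cyclic_subgroup G P"
    and PK: "internal_direct_product G P K" and minimal: "minimal_nonabelian_subgroup G K"
  shows "exponent_critical G"
proof (rule ccontr)
  assume "\<not> exponent_critical G"
  let ?S = "{grp_exp G H | H. subgroup H G \<and> H \<noteq> carrier G \<and> \<not> commutative_set G H}"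
  have eq: "grp_exp G (carrier G) = Lcm ?S"
    using \<open>\<not> exponent_critical G\<close> by (simp add: exponent_critical_def)
  have P: "subgroup P G" and K: "subgroup K G" and disj: "P \<inter> K = {\<one>}" and prod: "P <#> K = carrier G"
    and comm: "\<And>u k. \<lbrakk>u \<in> P; k \<in> K\<rbrakk> \<Longrightarrow> u \<otimes> k = k \<otimes> u"
    using PK by (auto simp: internal_direct_product_def)
  have p: "Factorial_Ring.prime p" and "p dvd order G" and card_P: "card P = p ^ multiplicity p (order G)"
    using sylow by (auto simp: sylow_subgroup_def)
  have order_pos: "order G > 0" using fin order_gt_0_iff_finite by blast
  interpret P: subgroup P G by (rule P)
  interpret K: subgroup K G by (rule K)
  define a where "a = multiplicity p (order G)"
  have a: "a > 0" 
    using \<open>p dvd order G\<close> p order_pos by (simp add: a_def prime_multiplicity_gt_zero_iff)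
  obtain g where g: "g \<in> carrier G" "P = generate G {g}" using cyclic by (auto simp: cyclic_subgroup_def)
  have ordg: "ord g = p ^ a" using generate_pow_card[OF g(1)] g(2) card_P by (simp add: a_def)
  have finP: "finite P" and finK: "finite K"
    using fin P.subset K.subset finite_subset by auto
  \<comment> \<open>\<open>order G\<close> is \<open>card P * card K\<close>, and \<open>P\<close>
    already takes up its whole \<open>p\<close>-part.\<close>
  have ndvd: "\<not> p dvd card K"
  proof
    assume dvd: "p dvd card K"
    have "inj_on (\<lambda>(u, k). u \<otimes> k) (P \<times> K)"
    proof (rule inj_onI, clarsimp)
      fix u k v l assume *: "u \<in> P" "k \<in> K" "v \<in> P" "l \<in> K" "u \<otimes> k = v \<otimes> l"
      then have G: "u \<in> carrier G" "k \<in> carrier G" "v \<in> carrier G" "l \<in> carrier G" by auto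
      have "inv v \<otimes> (u \<otimes> k) \<otimes> inv k = inv v \<otimes> (v \<otimes> l) \<otimes> inv k" using * by simp
      then have e: "inv v \<otimes> u = l \<otimes> inv k" using G by (simp add: m_assoc inv_cancel_left)
      moreover have "inv v \<otimes> u \<in> P" "l \<otimes> inv k \<in> K" using * by auto
      ultimately have "inv v \<otimes> u = \<one>" "l \<otimes> inv k = \<one>" using disj by auto
      then show "u = v \<and> k = l"
        using G by (metis inv_closed inv_equality inv_inv)
    qed
    moreover have "(\<lambda>(u, k). u \<otimes> k) ` (P \<times> K) = carrier G"
      unfolding prod[symmetric] set_mult_def by auto
    ultimately have "order G = card P * card K"
      unfolding order_def by (metis card_cartesian_product card_image)
    moreover have "p ^ a * p dvd card P * card K"
      using dvd card_P by (intro mult_dvd_mono) (simp_all add: a_def)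
    ultimately have "p ^ Suc a dvd order G"
      by (metis power_Suc2)
    then have "Suc a \<le> multiplicity p (order G)"
      using order_pos p by (intro multiplicity_geI) auto
    then show False by (simp add: a_def)
  qed
  have "ord g dvd grp_exp G (carrier G)"
    unfolding grp_exp_def using g(1) by (intro dvd_Lcm) blast
  then have "p ^ a dvd Lcm ?S" by (simp add: ordg eq)
  moreover have "finite ?S"
  proof (rule finite_subset)
    show "?S \<subseteq> grp_exp G ` Pow (carrier G)" using subgroup.subset by blast
  qed (use fin in simp)
  moreover have "Lcm ?S \<noteq> 0" using grp_exp_nonzero[OF fin order_refl] by (simp add: eq)
  ultimately obtain H where H: "subgroup H G" "H \<noteq> carrier G" "\<not> commutative_set G H" "p ^ a dvd grp_exp G H"
    using prime_power_dvd_Lcm[OF _ p a] by blast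
  interpret H: subgroup H G by (rule H)
  obtain h where h: "h \<in> H" "p ^ a dvd ord h"
    using prime_power_dvd_Lcm[OF _ p a, of "ord ` H"] H(4) grp_exp_nonzero[OF fin H.subset]
      finite_subset[OF H.subset fin] unfolding grp_exp_def by blast
  \<comment> \<open>Raising to the power \<open>card K\<close> kills the component in
    \<open>K\<close>, so \<open>w\<close> lies in \<open>P\<close>. As \<open>card K\<close> is
    prime to \<open>p\<close>, the \<open>p\<close>-part of the order survives and \<open>w\<close>
    generates \<open>P\<close>.\<close>
  define w where "w = h [^] card K"
  have "h [^] n \<in> H" for n :: nat
    using h(1) by (induction n) auto
  then have wH: "w \<in> H" unfolding w_def .
  have hG: "h \<in> carrier G" using h by simp
  have "h \<in> P <#> K" using hG prod by simp
  then obtain u k where uk: "u \<in> P" "k \<in> K" "h = u \<otimes> k" unfolding set_mult_def by blast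
  have "ord k dvd card K"
    using card_subgroup_dvd[OF generate_is_subgroup K generate_subgroup_incl[OF _ K]]
      uk(2) generate_pow_card[of k] by auto
  then have "k [^] card K = \<one>" using uk by (simp add: pow_eq_id)
  moreover have "w = u [^] card K \<otimes> k [^] card K"
    unfolding w_def uk(3) by (rule pow_mult_distrib[OF comm]) (use uk(1,2) in auto)
  ultimately have "w = u [^] card K" using uk by simp
  moreover have "u [^] (n::nat) \<in> P" for n using uk(1) by (induction n) auto
  ultimately have wP: "w \<in> P" by simp
  have "ord w = ord h div gcd (ord h) (card K)"
    using hG K.finite_imp_card_positive[OF fin] by (simp add: w_def ord_pow_gen)
  then have ordh: "ord h = ord w * gcd (ord h) (card K)" by simp
  have "coprime (p ^ a) (gcd (ord h) (card K))"
    using ndvd p by (meson coprime_power_left_iff dvd_trans gcd_dvd2 prime_imp_coprime)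
  then have "p ^ a dvd ord w"
    using h(2) ordh by (metis coprime_dvd_mult_left_iff)
  moreover have "ord w \<noteq> 0" using ord_ge_1[OF fin P.mem_carrier[OF wP]] by simp
  ultimately have "card P \<le> card (generate G {w})"
    using generate_pow_card[OF P.mem_carrier[OF wP]] card_P
    by (metis a_def dvd_imp_le gr0I)
  moreover have "generate G {w} \<subseteq> P" using wP by (intro generate_subgroup_incl[OF _ P]) simp
  ultimately have "generate G {w} = P" using finP by (intro card_seteq) auto
  moreover have "generate G {w} \<subseteq> H" using wH by (intro generate_subgroup_incl[OF _ H(1)]) simp
  ultimately have PH: "P \<subseteq> H" by simp
  have HK: "subgroup (H \<inter> K) G" by (rule subgroups_Inter_pair[OF H(1) K])
  have "H \<inter> K \<noteq> K"
  proof
    assume "H \<inter> K = K"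
    then have "P <#> K \<subseteq> H" using PH unfolding set_mult_def by auto
    then show False using prod H(2) H.subset by blast
  qed
  then have comm_HK: "commutative_set G (H \<inter> K)"
    using minimal HK unfolding minimal_nonabelian_subgroup_def by blast
  have comm_P: "u \<otimes> v = v \<otimes> u" if uv: "u \<in> P" "v \<in> P" for u v
  proof -
    obtain i j :: nat where "u = g [^] i" "v = g [^] j"
      using uv generate_pow_nat[OF g(1)] ordg p unfolding g(2) by auto
    then show ?thesis using g(1) by (simp add: nat_pow_mult add.commute)
  qed
  \<comment> \<open>Dedekind's law: because \<open>P\<close> lies in \<open>H\<close>, the component
    in \<open>K\<close> of an element of \<open>H\<close> is again in \<open>H\<close>.\<close>
  have decomp: "\<exists>u\<in>P. \<exists>k\<in>H \<inter> K. h = u \<otimes> k" if h: "h \<in> H" for h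
  proof -
    have "h \<in> P <#> K" using h prod by simp
    then obtain u k where uk: "u \<in> P" "k \<in> K" "h = u \<otimes> k" unfolding set_mult_def by blast
    then have "inv u \<otimes> h = k" by (simp add: inv_cancel_left)
    moreover have "inv u \<otimes> h \<in> H" using uk(1) PH h by auto
    ultimately have "k \<in> H" by simp
    with uk show ?thesis by blast
  qed
  have "a \<otimes> b = b \<otimes> a" if ab: "a \<in> H" "b \<in> H" for a b
  proof -
    obtain u k where uk: "u \<in> P" "k \<in> H \<inter> K" "a = u \<otimes> k" using decomp ab by blast
    obtain v l where vl: "v \<in> P" "l \<in> H \<inter> K" "b = v \<otimes> l" using decomp ab by blast
    have G: "u \<in> carrier G" "k \<in> carrier G" "v \<in> carrier G" "l \<in> carrier G" using uk vl by auto
    have "a \<otimes> b = u \<otimes> (k \<otimes> v) \<otimes> l" using G uk vl by (simp add: m_assoc)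
    also have "k \<otimes> v = v \<otimes> k" using comm[of v k] uk vl by simp
    also have "u \<otimes> (v \<otimes> k) \<otimes> l = (u \<otimes> v) \<otimes> (k \<otimes> l)" using G by (simp add: m_assoc)
    also have "u \<otimes> v = v \<otimes> u" using comm_P uk vl by simp
    also have "k \<otimes> l = l \<otimes> k" using comm_HK uk vl by (auto simp: commutative_set_def)
    also have "(v \<otimes> u) \<otimes> (l \<otimes> k) = v \<otimes> (u \<otimes> l) \<otimes> k" using G by (simp add: m_assoc)
    also have "u \<otimes> l = l \<otimes> u" using comm[of u l] uk vl by simp
    also have "v \<otimes> (l \<otimes> u) \<otimes> k = b \<otimes> a" using G uk vl by (simp add: m_assoc)
    finally show ?thesis .
  qed
  then show False using H(3) by (auto simp: commutative_set_def)
qed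

end

theorem theoremB:
  fixes G :: "('a, 'b) monoid_scheme"
  assumes "group G"
    and "finite (carrier G)"
    and "\<not> commutative_set G (carrier G)"
    and "card (prime_factors (order G)) = 3"
  shows "exponent_critical G \<longleftrightarrow>
    (\<exists>p P K. sylow_subgroup G p P \<and> cyclic_subgroup G P \<and>
       internal_direct_product G P K \<and> minimal_nonabelian_subgroup G K)"
  using group.exponent_critical_imp_direct_product[OF assms]
    group.direct_product_imp_exponent_critical[OF assms(1,2)] by blast

end
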